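(* Let $p\ge1$ and, for all integers $m\ge m_0$, let $\mathbb L_m=(B_1^{(m)},\dots,B_p^{(m)})$ be a list of $p$ distinct blocks of length $m$ over $\{0,1\}$. Let $z_1,\dots,z_p\in\{0,1\}^{\mathbb N}$ be such that, for all $i$ and $m$, $z_i$ belongs to the cylinder set of $B_i^{(m)}$ (i.e. $B_i^{(m)}$ is the block of the first $m$ symbols of $z_i$). Let $T$ be the left shift on $\{0,1\}^{\mathbb N}$ and for $i=1,\dots,p$ let $\ell(i)=\min\{j\ge1:T^jz_i\in\{z_1,\dots,z_p\}\}$, with $\ell(i)=+\infty$ if no such $j$ exists. Then $$\lim_{m\to\infty}\frac{\log2-h(\mathbb L_m)}{2^{-m}}=\sum_{i=1}^p\left(1-2^{-\ell(i)}\right),$$ where $2^{-\infty}=0$.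
   Context: $h(\mathbb L_m)$ (the Shannon capacity) is the topological entropy, with natural logarithm, of the subshift of $\{0,1\}^{\mathbb N}$ consisting of all sequences in which none of the blocks $B_1^{(m)},\dots,B_p^{(m)}$ occurs. *)

theory Defs
  imports "HOL-Analysis.Analysis" "HOL-Library.Extended_Nat"
begin

text \<open>Topological entropy of a continuous self-map of a compact space, in the sense of
  Adler, Konheim and McAndrew (open covers), with natural logarithms.\<close>

definition open_cover :: "'a topology \<Rightarrow> 'a set set \<Rightarrow> bool" where
  "open_cover X \<U> \<longleftrightarrow> (\<forall>U\<in>\<U>. openin X U) \<and> \<Union>\<U> = topspace X"

definition cover_number :: "'a topology \<Rightarrow> 'a set set \<Rightarrow> nat" where
  "cover_number X \<U> =
     (LEAST k. \<exists>\<V>. \<V> \<subseteq> \<U> \<and> finite \<V> \<and> topspace X \<subseteq> \<Union>\<V> \<and> card \<V> = k)"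

text \<open>The join of the covers \<open>\<U>, T\<^sup>-\<^sup>1\<U>, \<dots>, T\<^sup>-\<^sup>(\<^sup>n\<^sup>-\<^sup>1\<^sup>)\<U>\<close>.\<close>

definition iterated_join :: "'a topology \<Rightarrow> ('a \<Rightarrow> 'a) \<Rightarrow> 'a set set \<Rightarrow> nat \<Rightarrow> 'a set set" where
  "iterated_join X T \<U> n =
     {{x \<in> topspace X. \<forall>i<n. (T ^^ i) x \<in> U i} | U. \<forall>i<n. U i \<in> \<U>}"

text \<open>The limit superior is a limit, by subadditivity. Since \<open>ln 0 = 0\<close>, the empty space has
  entropy 0.\<close>

definition cover_entropy :: "'a topology \<Rightarrow> ('a \<Rightarrow> 'a) \<Rightarrow> 'a set set \<Rightarrow> ereal" where
  "cover_entropy X T \<U> =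
     limsup (\<lambda>n. ereal (ln (real (cover_number X (iterated_join X T \<U> n))) / real n))"

definition topological_entropy :: "'a topology \<Rightarrow> ('a \<Rightarrow> 'a) \<Rightarrow> ereal" where
  "topological_entropy X T = (SUP \<U>\<in>{\<U>. open_cover X \<U>}. cover_entropy X T \<U>)"

text \<open>The alphabet \<open>{0,1}\<close> is the type \<^typ>\<open>bool\<close>, with the discrete topology.\<close>

definition full_shift :: "(nat \<Rightarrow> bool) topology" where
  "full_shift = product_topology (\<lambda>_. discrete_topology UNIV) UNIV"

definition shift :: "(nat \<Rightarrow> bool) \<Rightarrow> (nat \<Rightarrow> bool)" where
  "shift x = (\<lambda>n. x (Suc n))"

definition cylinder :: "bool list \<Rightarrow> (nat \<Rightarrow> bool) set" where
  "cylinder w = {x. map x [0..<length w] = w}"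

definition occurs_in :: "bool list \<Rightarrow> (nat \<Rightarrow> bool) \<Rightarrow> bool" where
  "occurs_in w x \<longleftrightarrow> (\<exists>k. (shift ^^ k) x \<in> cylinder w)"

definition avoiding_subshift :: "bool list set \<Rightarrow> (nat \<Rightarrow> bool) set" where
  "avoiding_subshift F = {x. \<forall>w\<in>F. \<not> occurs_in w x}"

definition shannon_capacity :: "bool list set \<Rightarrow> ereal" where
  "shannon_capacity F =
     topological_entropy (subtopology full_shift (avoiding_subshift F)) shift"

definition hitting_time :: "(nat \<Rightarrow> bool) set \<Rightarrow> (nat \<Rightarrow> bool) \<Rightarrow> enat" where
  "hitting_time S x =
     (if \<exists>j\<ge>1. (shift ^^ j) x \<in> S then enat (LEAST j. j \<ge> 1 \<and> (shift ^^ j) x \<in> S) else \<infinity>)"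

fun two_power_minus :: "enat \<Rightarrow> real" where
  "two_power_minus (enat n) = 1 / 2 ^ n"
| "two_power_minus \<infinity> = 0"

end

theory Submission
  imports Defs "HOL-Library.Sublist" "HOL-Real_Asymp.Real_Asymp"
begin

text \<open>
  Let \<open>F\<close> consist of the blocks of length \<open>m\<close>, let \<open>A\<close> be the generating function of the number of words that avoid
  \<open>F\<close>, and \<open>R\<close> its radius of convergence. Then the entropy is \<open>- ln R\<close> (\<open>shannon_capacity_le\<close>,
  \<open>shannon_capacity_ge\<close>, \<open>capacity_radius\<close>), and the task is to find \<open>2 * R - 1\<close> up to \<open>o(2\<^sup>-\<^sup>m)\<close>.

  Let \<open>G\<^sub>u\<close> be the generating function of the words in which the first forbidden occurrence is \<open>u\<close>, at the end.
  Appending one letter, or appending a whole block \<open>u\<close>, to an avoiding word gives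
  \<open>\<Sum>\<^sub>u G\<^sub>u = (2x - 1) A + 1\<close> and \<open>x\<^sup>m A = \<Sum>\<^sub>v c\<^sub>v\<^sub>u(x) G\<^sub>v\<close>,
  where \<open>c\<^sub>v\<^sub>u(x)\<close> is the sum of \<open>x\<^sup>s\<close> over the shifts \<open>s\<close> at which \<open>u\<close> overlaps \<open>v\<close>
  (\<open>generating_function_equations\<close>). After division by \<open>A\<close> the term \<open>1 / A\<close> vanishes as \<open>x\<close> tends to \<open>R\<close>.

  For large \<open>m\<close> a shift \<open>s\<close> of bounded size is an overlap of \<open>B\<^sub>i\<close> with \<open>B\<^sub>j\<close> exactly when \<open>T\<^sup>s z\<^sub>j = z\<^sub>i\<close>, and larger
  shifts contribute little. Weight the equation of \<open>B\<^sub>i\<close> by \<open>1 - x ^ \<ell>(i)\<close>. Along the orbit of \<open>z\<^sub>j\<close> the weighted sum of the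
  \<open>x\<^sup>s\<close> over the visits to \<open>{z\<^sub>1, \<dots>, z\<^sub>p}\<close> telescopes to 1 (\<open>return_weight_telescope\<close>,
  \<open>weighted_overlap_bound\<close>), so that the right-hand sides add up to nearly \<open>\<Sum>\<^sub>v G\<^sub>v\<close>. At \<open>x = R\<close> this yields
  \<open>2R - 1 \<approx> R\<^sup>m \<Sum>\<^sub>i (1 - R ^ \<ell>(i))\<close> (\<open>radius_equation_approx\<close>). It remains to check that \<open>R\<close> tends to
  \<open>1/2\<close> so fast that \<open>(2R)\<^sup>m\<close> tends to 1 (\<open>radius_asymptotics\<close>).
\<close>

section \<open>Counting words that avoid a finite set of blocks\<close>

definition avoids :: "bool list set \<Rightarrow> bool list \<Rightarrow> bool" where
  "avoids F w \<longleftrightarrow> (\<forall>u\<in>F. \<not> sublist u w)"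

definition avoiding_words :: "bool list set \<Rightarrow> nat \<Rightarrow> bool list set" where
  "avoiding_words F n = {w. length w = n \<and> avoids F w}"

text \<open>For words of a common length at least 1, an occurrence inside \<open>w\<close> is either contained in \<open>butlast w\<close>
  or a suffix of \<open>w\<close>. Hence these are the words in which \<open>u\<close> is the first forbidden word to occur, and
  occurs only at the very end.\<close>
definition first_hits :: "bool list set \<Rightarrow> bool list \<Rightarrow> nat \<Rightarrow> bool list set" where
  "first_hits F u n = {w. length w = n \<and> w \<noteq> [] \<and> avoids F (butlast w) \<and> suffix u w}"

lemma avoids_sublist: "avoids F w \<Longrightarrow> sublist v w \<Longrightarrow> avoids F v"
  unfolding avoids_def by (meson sublist_order.order.trans)

lemma avoids_take: "avoids F w \<Longrightarrow> avoids F (take n w)"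
  by (erule avoids_sublist) simp

lemma avoids_drop: "avoids F w \<Longrightarrow> avoids F (drop n w)"
  by (erule avoids_sublist) simp

lemma avoids_appendD: "avoids F (v @ w) \<Longrightarrow> avoids F v"
  by (erule avoids_sublist) simp

lemma finite_words: "finite {w :: bool list. length w = n}"
  using finite_lists_length_eq[of "UNIV :: bool set" n] by simp

lemma finite_avoiding_words: "finite (avoiding_words F n)"
  unfolding avoiding_words_def by (rule finite_subset[OF _ finite_words[of n]]) auto

lemma finite_first_hits: "finite (first_hits F u n)"
  unfolding first_hits_def by (rule finite_subset[OF _ finite_words[of n]]) auto

lemma card_avoiding_words_add_le:
  assumes "finite R" and "\<And>w. w \<in> avoiding_words F (n + l) \<Longrightarrow> take n w \<in> R"
  shows "card (avoiding_words F (n + l)) \<le> card R * card (avoiding_words F l)"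
proof -
  have "card (avoiding_words F (n + l)) \<le> card (R \<times> avoiding_words F l)"
  proof (rule card_inj_on_le)
    show "inj_on (\<lambda>w. (take n w, drop n w)) (avoiding_words F (n + l))"
      by (rule inj_onI) (metis append_take_drop_id prod.inject)
    show "(\<lambda>w. (take n w, drop n w)) ` avoiding_words F (n + l) \<subseteq> R \<times> avoiding_words F l"
      using assms(2) by (auto simp: avoiding_words_def intro: avoids_drop)
    show "finite (R \<times> avoiding_words F l)"
      using assms(1) finite_avoiding_words by blast
  qed
  thus ?thesis by (simp add: card_cartesian_product)
qed

lemma card_avoiding_words_submult:
  "card (avoiding_words F (n + l)) \<le> card (avoiding_words F n) * card (avoiding_words F l)"
  by (rule card_avoiding_words_add_le[OF finite_avoiding_words])
     (auto simp: avoiding_words_def intro: avoids_take)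

lemma avoids_iff_no_suffix:
  assumes "w \<noteq> []" "avoids F (butlast w)"
  shows "avoids F w \<longleftrightarrow> (\<forall>u\<in>F. \<not> suffix u w)"
proof -
  have "sublist u w \<longleftrightarrow> suffix u w \<or> sublist u (butlast w)" for u
    using assms(1) sublist_snoc[of u "butlast w" "last w"] by simp
  thus ?thesis using assms(2) unfolding avoids_def by blast
qed

lemma suffix_same_length: "suffix u w \<Longrightarrow> suffix v w \<Longrightarrow> length u = length v \<Longrightarrow> u = v"
  by (metis order_refl suffix_length_suffix suffix_order.dual_order.eq_iff)

text \<open>Appending a letter to an avoiding word gives either an avoiding word or a word whose first
  forbidden occurrence is at the end; the forbidden suffix is unique because all lengths agree.\<close>
lemma card_avoiding_words_Suc:
  assumes "finite F" "\<And>u. u \<in> F \<Longrightarrow> length u = m"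
  shows "2 * card (avoiding_words F n) =
    card (avoiding_words F (Suc n)) + (\<Sum>u\<in>F. card (first_hits F u (Suc n)))"
proof -
  let ?E = "{w. length w = Suc n \<and> avoids F (butlast w)}"
  have fin: "finite ?E" by (rule finite_subset[OF _ finite_words[of "Suc n"]]) auto
  have "bij_betw (\<lambda>(w, b). w @ [b]) (avoiding_words F n \<times> UNIV) ?E"
    by (rule bij_betwI[where g = "\<lambda>w. (butlast w, last w)"])
       (auto simp: avoiding_words_def simp flip: length_0_conv)
  hence "card ?E = card (avoiding_words F n \<times> (UNIV :: bool set))"
    by (rule bij_betw_same_card[symmetric])
  hence E: "card ?E = 2 * card (avoiding_words F n)" by (simp add: card_cartesian_product)
  have "?E = avoiding_words F (Suc n) \<union> (\<Union>u\<in>F. first_hits F u (Suc n))"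
  proof (intro equalityI subsetI)
    fix w assume "w \<in> ?E"
    moreover from this have "w \<noteq> []" by auto
    ultimately show "w \<in> avoiding_words F (Suc n) \<union> (\<Union>u\<in>F. first_hits F u (Suc n))"
      using avoids_iff_no_suffix[of w F] by (auto simp: avoiding_words_def first_hits_def)
  next
    fix w assume "w \<in> avoiding_words F (Suc n) \<union> (\<Union>u\<in>F. first_hits F u (Suc n))"
    thus "w \<in> ?E"
      by (auto simp: avoiding_words_def first_hits_def butlast_conv_take intro: avoids_take)
  qed
  moreover have "avoiding_words F (Suc n) \<inter> (\<Union>u\<in>F. first_hits F u (Suc n)) = {}"
    by (auto simp: avoiding_words_def first_hits_def avoids_def)
  moreover have "card (\<Union>u\<in>F. first_hits F u (Suc n)) = (\<Sum>u\<in>F. card (first_hits F u (Suc n)))"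
  proof (rule card_UN_disjoint)
    show "\<forall>i\<in>F. \<forall>j\<in>F. i \<noteq> j \<longrightarrow> first_hits F i (Suc n) \<inter> first_hits F j (Suc n) = {}"
    proof (intro ballI impI)
      fix u v assume "u \<in> F" "v \<in> F" "u \<noteq> v"
      moreover from this have "\<not> (suffix u w \<and> suffix v w)" for w
        using suffix_same_length[of u w v] assms(2) by auto
      ultimately show "first_hits F u (Suc n) \<inter> first_hits F v (Suc n) = {}"
        by (auto simp: first_hits_def)
    qed
  qed (use assms finite_first_hits in auto)
  ultimately have "card ?E = card (avoiding_words F (Suc n)) + (\<Sum>u\<in>F. card (first_hits F u (Suc n)))"
    using assms(1) by (simp add: card_Un_disjoint finite_avoiding_words finite_first_hits)
  with E show ?thesis by simp
qed

text \<open>Append \<open>u\<close> to an avoiding word \<open>w\<close> letter by letter. The first prefix of \<open>w @ u\<close> that is not avoiding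
  ends in some \<open>v \<in> F\<close> and contains only \<open>m - s\<close> letters of \<open>u\<close>, so that the last \<open>m - s\<close> letters of \<open>v\<close>
  are the first \<open>m - s\<close> letters of \<open>u\<close>. Conversely \<open>w\<close> is recovered from this prefix by deleting
  those letters. This is the overlap identity of Guibas and Odlyzko.\<close>
lemma card_avoiding_words_overlap:
  assumes "finite F" "\<And>v. v \<in> F \<Longrightarrow> length v = m" "u \<in> F" 
  shows "card (avoiding_words F n) =
    (\<Sum>v\<in>F. \<Sum>s<m. if drop s v = take (m - s) u then card (first_hits F v (n + (m - s))) else 0)"
proof -
  have lu: "length u = m" using assms by blast
  \<comment> \<open>the avoiding words whose extension by \<open>u\<close> first hits \<open>v\<close>, with \<open>s\<close> letters of \<open>v\<close> in front of \<open>u\<close>\<close>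
  define P where "P = (\<lambda>(v, s). {w. length w = n \<and> w @ take (m - s) u \<in> first_hits F v (n + (m - s))})"
  have av: "avoids F (w @ take t u)" if "t' > t" "t' \<le> m" "avoids F (butlast (w @ take t' u))"
    for w t t'
  proof -
    have "w @ take t u = take (length w + t) (butlast (w @ take t' u))"
      using that lu by (simp add: butlast_conv_take take_append min_def)
    thus ?thesis using that avoids_take by metis
  qed
  have "avoiding_words F n = (\<Union>q\<in>F \<times> {..<m}. P q)"
  proof (intro equalityI subsetI)
    fix w assume w: "w \<in> avoiding_words F n"
    hence aw: "avoids F w" "length w = n" by (auto simp: avoiding_words_def)
    have "\<not> avoids F (w @ take m u)" using assms lu by (auto simp: avoids_def)
    moreover have "avoids F (w @ take 0 u)" using aw by simp
    ultimately obtain t where t: "t < m" "avoids F (w @ take t u)" "\<not> avoids F (w @ take (Suc t) u)"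
      using ex_least_nat_less[of "\<lambda>t. \<not> avoids F (w @ take t u)" m]
      by (metis less_eq_Suc_le order_refl)
    let ?y = "w @ take (Suc t) u"
    have b: "butlast ?y = w @ take t u" "?y \<noteq> []"
      using t lu by (auto simp: take_Suc_conv_app_nth butlast_append)
    then obtain v where v: "v \<in> F" "suffix v ?y" using avoids_iff_no_suffix[of ?y F] t by auto
    have "m - (m - Suc t) = Suc t" "length ?y = n + Suc t" using t lu aw by auto
    hence "w \<in> P (v, m - Suc t)" using aw t v b unfolding P_def first_hits_def by auto
    thus "w \<in> (\<Union>q\<in>F \<times> {..<m}. P q)" using v t by force
  next
    fix w assume "w \<in> (\<Union>q\<in>F \<times> {..<m}. P q)"
    then obtain v s where q: "v \<in> F" "s < m" "w \<in> P (v, s)" by auto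
    hence "avoids F (w @ take 0 u)"
      by (intro av[of 0 "m - s"]) (auto simp: P_def first_hits_def)
    thus "w \<in> avoiding_words F n" using q by (auto simp: P_def avoiding_words_def)
  qed
  also have "card \<dots> = (\<Sum>q\<in>F \<times> {..<m}. card (P q))"
  proof (rule card_UN_disjoint)
    show "finite (F \<times> {..<m})" using assms by simp
    show "\<forall>q\<in>F \<times> {..<m}. finite (P q)"
      by (auto simp: P_def intro: finite_subset[OF _ finite_words[of n]])
    have no: False if "v \<in> F" "v' \<in> F" "s < m" "s' < m" "s' < s" "w \<in> P (v, s)" "w \<in> P (v', s')"
      for v v' s s' w
    proof -
      have "avoids F (w @ take (m - s) u)"
        by (rule av[of _ "m - s'"]) (use that in \<open>auto simp: P_def first_hits_def\<close>)
      moreover have "suffix v (w @ take (m - s) u)" using that by (auto simp: P_def first_hits_def)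
      ultimately show False using that unfolding avoids_def by blast
    qed
    have eq: "v = v'" if "v \<in> F" "v' \<in> F" "w \<in> P (v, s)" "w \<in> P (v', s)" for v v' s w
    proof (rule suffix_same_length)
      show "suffix v (w @ take (m - s) u)" "suffix v' (w @ take (m - s) u)"
        using that by (auto simp: P_def first_hits_def)
      show "length v = length v'" using that assms(2) by simp
    qed
    show "\<forall>q\<in>F \<times> {..<m}. \<forall>q'\<in>F \<times> {..<m}. q \<noteq> q' \<longrightarrow> P q \<inter> P q' = {}"
    proof (intro ballI impI)
      fix q q' assume "q \<in> F \<times> {..<m}" "q' \<in> F \<times> {..<m}" "q \<noteq> q'"
      moreover obtain v s v' s' where "q = (v, s)" "q' = (v', s')" by fastforce
      ultimately show "P q \<inter> P q' = {}"
        using no[of v v' s s'] no[of v' v s' s] eq[of v v' _ s] by (cases s s' rule: linorder_cases) auto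
    qed
  qed
  also have "\<dots> = (\<Sum>v\<in>F. \<Sum>s<m. card (P (v, s)))" by (simp add: sum.cartesian_product)
  also have "\<dots> = (\<Sum>v\<in>F. \<Sum>s<m. if drop s v = take (m - s) u then card (first_hits F v (n + (m - s))) else 0)"
  proof (intro sum.cong refl)
    fix v s assume vs: "v \<in> F" "s \<in> {..<m}"
    have lv: "length v = m" using vs assms by blast
    let ?t = "m - s"
    have key: "drop s v = drop n g" if "suffix v g" "length g = n + ?t" for g
    proof -
      from that obtain h where h: "g = h @ v" by (auto simp: suffix_def)
      hence "length h + m = n + (m - s)" using that lv by simp
      hence "n = length h + s" using vs by simp
      thus ?thesis using h by simp
    qed
    show "card (P (v, s)) = (if drop s v = take ?t u then card (first_hits F v (n + ?t)) else 0)"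
    proof (cases "drop s v = take ?t u")
      case True
      have "bij_betw (\<lambda>w. w @ take ?t u) (P (v, s)) (first_hits F v (n + ?t))"
      proof (rule bij_betwI[where g = "take n"])
        show "take n \<in> first_hits F v (n + ?t) \<rightarrow> P (v, s)"
        proof
          fix g assume g: "g \<in> first_hits F v (n + ?t)"
          hence "take n g @ take ?t u = g"
            using key[of g] True by (auto simp: first_hits_def)
          thus "take n g \<in> P (v, s)" using g lu by (auto simp: P_def first_hits_def)
        qed
        show "take n g @ take ?t u = g" if "g \<in> first_hits F v (n + ?t)" for g
          using key[of g] True that by (auto simp: first_hits_def)
      qed (auto simp: P_def)
      thus ?thesis using True by (auto dest: bij_betw_same_card)
    next
      case False
      have "w \<notin> P (v, s)" for w
        using key[of "w @ take ?t u"] False lu by (auto simp: P_def first_hits_def)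
      hence "P (v, s) = {}" by blast
      thus ?thesis using False by simp
    qed
  qed
  finally show ?thesis .
qed

section \<open>Generating functions\<close>

text \<open>A submultiplicative sequence decays geometrically along blocks of length \<open>k\<close> as soon as one
  term \<open>b k\<close> is below 1. Read contrapositively, this replaces Fekete's lemma: every term of a
  divergent submultiplicative series is at least 1.\<close>
lemma summable_submult:
  fixes b :: "nat \<Rightarrow> real"
  assumes nn: "\<And>n. 0 \<le> b n" and sm: "\<And>n k. b (n + k) \<le> b n * b k" and k: "b k < 1"
  shows "summable b"
proof (cases "k = 0")
  case True
  have "b n = 0" for n
  proof (rule ccontr)
    assume "b n \<noteq> 0"
    hence "b 0 * b n < b n" using nn[of n] k True by simp
    thus False using sm[of 0 n] by simp
  qed
  hence "b = (\<lambda>_. 0)" by (rule ext)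
  thus ?thesis by simp
next
  case False
  let ?C = "\<Sum>r<k. b r"
  have C: "0 \<le> ?C" by (simp add: nn sum_nonneg)
  have block: "b (j * k + r) \<le> b k ^ j * b r" for j r
  proof (induction j)
    case (Suc j)
    have "b (Suc j * k + r) \<le> b k * b (j * k + r)"
      using sm[of k "j * k + r"] by (simp add: add.assoc)
    also have "\<dots> \<le> b k * (b k ^ j * b r)" using Suc nn by (intro mult_left_mono)
    finally show ?case by (simp add: mult.assoc)
  qed simp
  have shift: "sum b {c..<c + k} = (\<Sum>r<k. b (c + r))" for c
    using sum.atLeastLessThan_shift_0[of b c "c + k"] by (simp add: comp_def atLeast0LessThan)
  show ?thesis
  proof (rule summableI_nonneg_bounded[OF nn])
    fix n
    have "sum b {..<n} \<le> sum b {..<n * k}"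
      using False nn by (intro sum_mono2) auto
    also have "\<dots> = (\<Sum>j<n. sum b {j * k..<j * k + k})" by (simp add: sum.nat_group)
    also have "\<dots> = (\<Sum>j<n. \<Sum>r<k. b (j * k + r))"
      by (simp add: shift)
    also have "\<dots> \<le> (\<Sum>j<n. \<Sum>r<k. b k ^ j * b r)" by (intro sum_mono block)
    also have "\<dots> = (\<Sum>j<n. b k ^ j) * ?C" by (simp add: sum_product)
    also have "\<dots> \<le> (\<Sum>j. b k ^ j) * ?C"
      using k nn C by (intro mult_right_mono sum_le_suminf summable_geometric) auto
    finally show "sum b {..<n} \<le> (\<Sum>j. b k ^ j) * ?C" .
  qed
qed

lemma ge_1_if_not_summable:
  assumes "0 \<le> x" "\<not> summable (\<lambda>n. real (card (avoiding_words F n)) * x ^ n)"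
  shows "1 \<le> real (card (avoiding_words F n)) * x ^ n"
proof (rule ccontr)
  let ?b = "\<lambda>n. real (card (avoiding_words F n)) * x ^ n"
  assume "\<not> 1 \<le> ?b n"
  moreover have "?b (n + k) \<le> ?b n * ?b k" for n k
  proof -
    have "?b (n + k) \<le> real (card (avoiding_words F n) * card (avoiding_words F k)) * x ^ (n + k)"
      using assms(1) card_avoiding_words_submult by (intro mult_right_mono of_nat_mono) auto
    thus ?thesis by (simp add: power_add mult_ac)
  qed
  ultimately have "summable ?b" using assms(1) by (intro summable_submult[of ?b n]) auto
  thus False using assms(2) by blast
qed

text \<open>The correlation polynomial of Guibas and Odlyzko: its exponents are the shifts by which a copy of \<open>u\<close>
  can start inside an occurrence of \<open>v\<close> (for words of equal length).\<close>
definition overlap :: "bool list \<Rightarrow> bool list \<Rightarrow> real \<Rightarrow> real" where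
  "overlap v u x = (\<Sum>s<length v. if drop s v = take (length v - s) u then x ^ s else 0)"

text \<open>The two counting identities become linear equations for the generating functions \<open>A\<close> of the
  avoiding words and \<open>G u\<close> of the first occurrences. The function \<open>\<phi>\<close> is \<open>G u / A\<close>, which stays bounded
  when \<open>x\<close> approaches the radius of convergence while \<open>A\<close> itself blows up.\<close>
lemma generating_function_equations:
  fixes F :: "bool list set" and x :: real
  defines "A \<equiv> \<Sum>n. real (card (avoiding_words F n)) * x ^ n"
  assumes fin: "finite F" and len: "\<And>u. u \<in> F \<Longrightarrow> length u = m" and m: "1 \<le> m"
    and x: "0 \<le> x" and summ: "summable (\<lambda>n. real (card (avoiding_words F n)) * x ^ n)"
  obtains \<phi> where "\<And>u. 0 \<le> \<phi> u" "(\<Sum>u\<in>F. \<phi> u) = 2 * x - 1 + 1 / A"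
    "\<And>u. u \<in> F \<Longrightarrow> x ^ m = (\<Sum>v\<in>F. overlap v u x * \<phi> v)"
proof -
  define a where "a n = real (card (avoiding_words F n))" for n
  define f where "f u n = (if u \<in> F then real (card (first_hits F u n)) else 0)" for u n
  define G where "G u = (\<Sum>n. f u n * x ^ n)" for u
  have a_sums: "(\<lambda>n. a n * x ^ n) sums A"
    using summ unfolding A_def a_def by (rule summable_sums)
  have a0: "a 0 = 1"
  proof -
    have "avoiding_words F 0 = {[]}" using len m by (fastforce simp: avoiding_words_def avoids_def)
    thus ?thesis by (simp add: a_def)
  qed
  have rec: "2 * a n = a (Suc n) + (\<Sum>u\<in>F. f u (Suc n))" for n
  proof -
    have "real (2 * card (avoiding_words F n)) =
        real (card (avoiding_words F (Suc n)) + (\<Sum>u\<in>F. card (first_hits F u (Suc n))))"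
      using card_avoiding_words_Suc[OF fin len, of n] by simp
    thus ?thesis by (simp add: a_def f_def)
  qed
  have f_short: "f u n = 0" if "n < m" for u n
  proof (cases "u \<in> F")
    case True
    hence "first_hits F u n = {}"
      using that len[OF True] suffix_length_le by (fastforce simp: first_hits_def)
    thus ?thesis by (simp add: f_def)
  qed (simp add: f_def)
  have f_nonneg: "0 \<le> f u n" for u n by (simp add: f_def)
  have f_le: "f u (Suc n) \<le> 2 * a n" for u n
  proof (cases "u \<in> F")
    case True
    have "f u (Suc n) \<le> (\<Sum>u\<in>F. f u (Suc n))" using True fin f_nonneg by (intro member_le_sum) auto
    thus ?thesis using rec[of n] by (simp add: a_def)
  qed (simp add: f_def a_def)
  have f_summ: "summable (\<lambda>n. f u n * x ^ n)" for u
  proof -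
    have "summable (\<lambda>n. f u (Suc n) * x ^ Suc n)"
    proof (rule summable_comparison_test')
      show "summable (\<lambda>n. 2 * x * (a n * x ^ n))" using a_sums by (intro summable_mult sums_summable)
      show "norm (f u (Suc n) * x ^ Suc n) \<le> 2 * x * (a n * x ^ n)" for n
        using mult_right_mono[OF f_le[of u n], of "x ^ Suc n"] x f_nonneg by (simp add: mult_ac)
    qed
    thus ?thesis by (subst (asm) summable_Suc_iff)
  qed
  have f_shift: "(\<lambda>n. f u (n + t) * x ^ (n + t)) sums G u" if "t \<le> m" for u t
    using f_summ[of u] f_short that
    by (subst sums_zero_iff_shift[of t "\<lambda>n. f u n * x ^ n"]) (auto simp: G_def)
  have G_nonneg: "0 \<le> G u" for u
    unfolding G_def using f_summ f_nonneg x by (intro suminf_nonneg) auto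
  have "(\<lambda>n. a (Suc n) * x ^ Suc n) sums (A - 1)"
    using a_sums a0 sums_Suc_iff[of "\<lambda>n. a n * x ^ n" "A - 1"] by simp
  hence "(\<lambda>n. a (Suc n) * x ^ Suc n + (\<Sum>u\<in>F. f u (n + 1) * x ^ (n + 1))) sums
      ((A - 1) + (\<Sum>u\<in>F. G u))"
    using m by (intro sums_add sums_sum f_shift)
  moreover have "(\<lambda>n. a (Suc n) * x ^ Suc n + (\<Sum>u\<in>F. f u (n + 1) * x ^ (n + 1))) =
      (\<lambda>n. 2 * x * (a n * x ^ n))"
  proof
    fix n
    have "2 * x * (a n * x ^ n) = (2 * a n) * x ^ Suc n" by simp
    also have "\<dots> = a (Suc n) * x ^ Suc n + (\<Sum>u\<in>F. f u (n + 1) * x ^ (n + 1))"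
      by (simp only: rec ring_distribs sum_distrib_right Suc_eq_plus1)
    finally show "a (Suc n) * x ^ Suc n + (\<Sum>u\<in>F. f u (n + 1) * x ^ (n + 1)) = 2 * x * (a n * x ^ n)"
      by simp
  qed
  ultimately have eq1: "2 * x * A = (A - 1) + (\<Sum>u\<in>F. G u)"
    using sums_mult[OF a_sums, of "2 * x"] sums_unique2 by metis
  have eq2: "x ^ m * A = (\<Sum>v\<in>F. overlap v u x * G v)" if u: "u \<in> F" for u
  proof -
    let ?c = "\<lambda>v s. if drop s v = take (m - s) u then x ^ s else 0"
    have "(\<lambda>n. \<Sum>v\<in>F. \<Sum>s<m. ?c v s * (f v (n + (m - s)) * x ^ (n + (m - s)))) sums
        (\<Sum>v\<in>F. \<Sum>s<m. ?c v s * G v)"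
      by (intro sums_sum sums_mult f_shift) simp
    moreover have "(\<Sum>v\<in>F. \<Sum>s<m. ?c v s * (f v (n + (m - s)) * x ^ (n + (m - s)))) =
        x ^ m * (a n * x ^ n)" for n
    proof -
      have a_n: "a n = (\<Sum>v\<in>F. \<Sum>s<m. real
          (if drop s v = take (m - s) u then card (first_hits F v (n + (m - s))) else 0))"
        using card_avoiding_words_overlap[OF fin _ u, of m n] len unfolding a_def of_nat_sum[symmetric]
        by simp
      have "x ^ m * (a n * x ^ n) = (\<Sum>v\<in>F. \<Sum>s<m. x ^ (n + m) * real
          (if drop s v = take (m - s) u then card (first_hits F v (n + (m - s))) else 0))"
        by (simp add: a_n sum_distrib_left power_add mult_ac)
      also have "\<dots> = (\<Sum>v\<in>F. \<Sum>s<m. ?c v s * (f v (n + (m - s)) * x ^ (n + (m - s))))"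
      proof (intro sum.cong refl)
        fix v s assume "v \<in> F" "s \<in> {..<m}"
        moreover from this have "x ^ (n + m) = x ^ s * x ^ (n + (m - s))"
          by (simp flip: power_add)
        ultimately show "x ^ (n + m) * real
            (if drop s v = take (m - s) u then card (first_hits F v (n + (m - s))) else 0) =
            ?c v s * (f v (n + (m - s)) * x ^ (n + (m - s)))"
          by (simp add: f_def)
      qed
      finally show ?thesis by simp
    qed
    ultimately have "x ^ m * A = (\<Sum>v\<in>F. \<Sum>s<m. ?c v s * G v)"
      using sums_mult[OF a_sums, of "x ^ m"] by (simp add: sums_unique2)
    also have "\<dots> = (\<Sum>v\<in>F. overlap v u x * G v)"
      by (intro sum.cong refl) (simp add: overlap_def len sum_distrib_right)
    finally show ?thesis .
  qed
  have "1 \<le> A"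
  proof -
    have "(\<Sum>n<1. a n * x ^ n) \<le> A"
      unfolding sums_unique[OF a_sums]
      using a_sums x by (intro sum_le_suminf) (auto simp: a_def sums_iff)
    thus ?thesis using a0 by simp
  qed
  show thesis
  proof (rule that[of "\<lambda>u. G u / A"])
    show "0 \<le> G u / A" for u using G_nonneg \<open>1 \<le> A\<close> by simp
    show "(\<Sum>u\<in>F. G u / A) = 2 * x - 1 + 1 / A"
      using eq1 \<open>1 \<le> A\<close> by (simp add: field_simps flip: sum_divide_distrib)
    show "x ^ m = (\<Sum>v\<in>F. overlap v u x * (G v / A))" if "u \<in> F" for u
      using eq2[OF that] \<open>1 \<le> A\<close> by (simp add: field_simps flip: sum_divide_distrib)
  qed
qed

section \<open>Entropy of the subshift\<close>

definition stem :: "(nat \<Rightarrow> bool) \<Rightarrow> nat \<Rightarrow> bool list" where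
  "stem x n = map x [0..<n]"

lemma length_stem [simp]: "length (stem x n) = n"
  by (simp add: stem_def)

lemma stem_eq_iff: "stem x n = stem y n \<longleftrightarrow> (\<forall>i<n. x i = y i)"
  by (auto simp: stem_def)

lemma take_stem: "k \<le> n \<Longrightarrow> take k (stem x n) = stem x k"
  by (simp add: stem_def take_map)

lemma drop_stem: "drop k (stem x n) = stem ((shift ^^ k) x) (n - k)"
proof -
  have "(shift ^^ k) x = (\<lambda>n. x (n + k))"
    by (induction k arbitrary: x) (auto simp: shift_def)
  thus ?thesis by (intro nth_equalityI) (auto simp: stem_def add.commute)
qed

lemma cylinder_iff_stem: "x \<in> cylinder w \<longleftrightarrow> stem x (length w) = w"
  by (simp add: cylinder_def stem_def)

lemma occurs_in_iff: "occurs_in w x \<longleftrightarrow> (\<exists>n. sublist w (stem x n))"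
proof
  assume "occurs_in w x"
  then obtain k where "stem ((shift ^^ k) x) (length w) = w"
    by (auto simp: occurs_in_def cylinder_iff_stem)
  hence "drop k (stem x (k + length w)) = w" by (simp add: drop_stem)
  thus "\<exists>n. sublist w (stem x n)" by (metis sublist_drop)
next
  assume "\<exists>n. sublist w (stem x n)"
  then obtain n ps ss where n: "stem x n = ps @ w @ ss" by (auto simp: sublist_def)
  have "stem ((shift ^^ length ps) x) (n - length ps) = w @ ss"
    using drop_stem[of "length ps" x n] n by simp
  moreover have "length w \<le> n - length ps" using arg_cong[OF n, of length] by simp
  ultimately have "stem ((shift ^^ length ps) x) (length w) = w"
    by (metis append_eq_conv_conj take_stem)
  thus "occurs_in w x" by (auto simp: occurs_in_def cylinder_iff_stem)
qed

lemma avoiding_subshift_iff: "x \<in> avoiding_subshift F \<longleftrightarrow> (\<forall>n. avoids F (stem x n))"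
  by (auto simp: avoiding_subshift_def occurs_in_iff avoids_def)

lemma shift_avoiding_subshift:
  "x \<in> avoiding_subshift F \<Longrightarrow> (shift ^^ k) x \<in> avoiding_subshift F"
  unfolding avoiding_subshift_iff using avoids_drop[of F "stem x (_ + k)" k]
  by (metis add_diff_cancel_right' drop_stem)

text \<open>If a word has extensions of every length, so has one of its two extensions by a letter. This
  takes the place of compactness of the shift space, both for Lebesgue numbers of open covers and
  for passing from avoiding words to words occurring in avoiding sequences.\<close>
lemma koenig:
  assumes mono: "\<And>v v'. P (v @ v') \<Longrightarrow> P v" and long: "\<And>N. \<exists>v. length v = N \<and> P (w @ v)"
  shows "\<exists>x. stem x (length w) = w \<and> (\<forall>n. P (stem x n))"
proof -
  define Q where "Q u \<longleftrightarrow> (\<forall>N. \<exists>v. length v = N \<and> P (u @ v))" for u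
  have step: "\<exists>b. Q (u @ [b])" if "Q u" for u
  proof (rule ccontr)
    assume "\<nexists>b. Q (u @ [b])"
    then obtain N where N: "\<And>b v. length v = N b \<Longrightarrow> \<not> P ((u @ [b]) @ v)"
      unfolding Q_def by metis
    have no: "\<not> P (u @ b # v)" if "length v \<ge> N b" for b v
    proof
      assume "P (u @ b # v)"
      hence "P (((u @ [b]) @ take (N b) v) @ drop (N b) v)" by simp
      hence "P ((u @ [b]) @ take (N b) v)" by (rule mono)
      thus False using N that by simp
    qed
    obtain v where v: "length v = Suc (max (N True) (N False))" "P (u @ v)"
      using \<open>Q u\<close> unfolding Q_def by blast
    then obtain b v' where "v = b # v'" by (cases v) auto
    thus False using no[of b v'] v by (cases b) auto
  qed
  have "\<exists>g. g 0 = w \<and> (\<forall>n. Q (g n) \<and> (\<exists>b. g (Suc n) = g n @ [b]))"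
    using dependent_nat_choice[of "\<lambda>n u. Q u \<and> (n = 0 \<longrightarrow> u = w)" "\<lambda>n u u'. \<exists>b. u' = u @ [b]"]
      step long Q_def by (metis nat.distinct(1))
  then obtain g where g: "g 0 = w" "\<And>n. Q (g n)" "\<And>n. \<exists>b. g (Suc n) = g n @ [b]" by blast
  have len: "length (g n) = length w + n" for n
  proof (induction n)
    case (Suc n)
    obtain b where "g (Suc n) = g n @ [b]" using g(3) by blast
    with Suc show ?case by simp
  qed (simp add: g(1))
  have pre: "prefix (g n) (g (n + k))" for n k
  proof (induction k)
    case (Suc k)
    obtain b where "g (Suc (n + k)) = g (n + k) @ [b]" using g(3) by blast
    hence "prefix (g (n + k)) (g (n + Suc k))" by simp
    with Suc show ?case by (rule prefix_order.trans)
  qed simp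
  define x where "x i = g (Suc i) ! i" for i
  have nth: "g n ! i = x i" if "i < length w + n" for i n
  proof (cases "n \<le> Suc i")
    case True
    then obtain k where "Suc i = n + k" using le_Suc_ex by blast
    hence "prefix (g n) (g (Suc i))" using pre[of n k] by simp
    thus ?thesis using that len by (auto simp: x_def prefix_def nth_append)
  next
    case False
    then obtain k where "n = Suc i + k" using le_Suc_ex[of "Suc i" n] by auto
    hence "prefix (g (Suc i)) (g n)" using pre[of "Suc i" k] by simp
    moreover have "i < length (g (Suc i))" using len by simp
    ultimately show ?thesis by (auto simp: x_def prefix_def nth_append)
  qed
  have stem: "stem x (length w + n) = g n" for n
    by (intro nth_equalityI) (auto simp: len nth stem_def)
  have "P (stem x n)" for n
  proof -
    have "P (g n @ [])" using g(2)[of n] unfolding Q_def by (metis length_0_conv)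
    hence "P (stem x (length w + n))" using stem by simp
    moreover have "stem x (length w + n) = stem x n @ drop n (stem x (length w + n))"
      by (metis append_take_drop_id le_add2 take_stem)
    ultimately show ?thesis using mono by metis
  qed
  moreover have "stem x (length w) = w" using stem[of 0] g(1) by simp
  ultimately show ?thesis by blast
qed

lemma topspace_full_shift [simp]: "topspace full_shift = UNIV"
  by (simp add: full_shift_def)

lemma openin_full_shift_stem:
  assumes "openin full_shift U" "x \<in> U"
  shows "\<exists>n. \<forall>y. stem y n = stem x n \<longrightarrow> y \<in> U"
proof -
  obtain W where W: "finite {i. W i \<noteq> (UNIV :: bool set)}" "x \<in> Pi\<^sub>E UNIV W" "Pi\<^sub>E UNIV W \<subseteq> U"
    using assms unfolding full_shift_def openin_product_topology_alt by force
  obtain n where n: "{i. W i \<noteq> UNIV} \<subseteq> {..<n}"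
    using W(1) finite_nat_iff_bounded by blast
  have "y \<in> U" if "stem y n = stem x n" for y
  proof -
    have "y i \<in> W i" for i
    proof (cases "i < n")
      case True
      thus ?thesis using that W(2) by (auto simp: stem_eq_iff)
    next
      case False
      hence "W i = UNIV" using n by auto
      thus ?thesis by simp
    qed
    thus ?thesis using W(3) by auto
  qed
  thus ?thesis by blast
qed

text \<open>Otherwise, for every \<open>k\<close> some cylinder of length \<open>k\<close> of the subshift fits in no member of the cover.
  This property of words is inherited by prefixes, so a single sequence has it for all \<open>k\<close>,
  although that sequence lies in an open member of the cover.\<close>
lemma Lebesgue_length:
  assumes "open_cover (subtopology full_shift (avoiding_subshift F)) \<U>"
  shows "\<exists>k. \<forall>x\<in>avoiding_subshift F. \<exists>V\<in>\<U>. \<forall>y\<in>avoiding_subshift F. stem y k = stem x k \<longrightarrow> y \<in> V"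
proof (rule ccontr)
  let ?S = "avoiding_subshift F"
  define P where "P w \<longleftrightarrow> (\<exists>x\<in>?S. stem x (length w) = w) \<and>
    (\<forall>V\<in>\<U>. \<exists>y\<in>?S. stem y (length w) = w \<and> y \<notin> V)" for w
  assume "\<nexists>k. \<forall>x\<in>?S. \<exists>V\<in>\<U>. \<forall>y\<in>?S. stem y k = stem x k \<longrightarrow> y \<in> V"
  hence bad: "\<exists>x\<in>?S. \<forall>V\<in>\<U>. \<exists>y\<in>?S. stem y N = stem x N \<and> y \<notin> V" for N by simp
  have "\<exists>v. length v = N \<and> P ([] @ v)" for N
  proof -
    obtain x where "x \<in> ?S" "\<forall>V\<in>\<U>. \<exists>y\<in>?S. stem y N = stem x N \<and> y \<notin> V" using bad by blast
    hence "P (stem x N)" unfolding P_def by auto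
    thus ?thesis by (intro exI[of _ "stem x N"]) simp
  qed
  moreover have "P v" if "P (v @ v')" for v v'
  proof -
    have "stem x (length v) = v" if "stem x (length (v @ v')) = v @ v'" for x
      using that take_stem[of "length v" "length (v @ v')" x] by simp
    with that show ?thesis unfolding P_def by blast
  qed
  ultimately obtain x where x: "\<And>n. P (stem x n)"
    using koenig[of P "[]"] by blast
  have "x \<in> ?S" unfolding avoiding_subshift_iff
  proof
    fix n
    obtain x' where "x' \<in> ?S" "stem x' n = stem x n" using x[of n] by (auto simp: P_def)
    thus "avoids F (stem x n)" by (metis avoiding_subshift_iff)
  qed
  moreover have "\<Union>\<U> = ?S" using assms by (simp add: open_cover_def)
  ultimately obtain V where V: "V \<in> \<U>" "x \<in> V" by blast
  then obtain U where U: "openin full_shift U" "V = U \<inter> ?S"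
    using assms by (auto simp: open_cover_def openin_subtopology)
  then obtain n where "\<forall>y. stem y n = stem x n \<longrightarrow> y \<in> U"
    using openin_full_shift_stem[of U x] V by blast
  thus False using x[of n] V(1) U(2) unfolding P_def by auto
qed

text \<open>Members of the cover contain cylinders of a fixed length \<open>k\<close>, hence members of the \<open>n\<close>-fold join
  contain cylinders of length \<open>n + k\<close>, of which there are no more than avoiding words.\<close>
lemma iterated_join_subcover:
  assumes "open_cover (subtopology full_shift (avoiding_subshift F)) \<U>"
  shows "\<exists>k. \<forall>n. \<exists>\<V>\<subseteq>iterated_join (subtopology full_shift (avoiding_subshift F)) shift \<U> n.
    finite \<V> \<and> avoiding_subshift F \<subseteq> \<Union>\<V> \<and> card \<V> \<le> card (avoiding_words F (n + k))"
proof -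
  let ?S = "avoiding_subshift F"
  let ?J = "iterated_join (subtopology full_shift ?S) shift \<U>"
  obtain k where k: "\<forall>x\<in>?S. \<exists>V\<in>\<U>. \<forall>y\<in>?S. stem y k = stem x k \<longrightarrow> y \<in> V"
    using Lebesgue_length[OF assms] by blast
  have "\<exists>\<V>\<subseteq>?J n. finite \<V> \<and> ?S \<subseteq> \<Union>\<V> \<and> card \<V> \<le> card (avoiding_words F (n + k))" for n
  proof -
    let ?R = "(\<lambda>x. stem x (n + k)) ` ?S"
    have "\<exists>J\<in>?J n. \<forall>y\<in>?S. stem y (n + k) = stem x (n + k) \<longrightarrow> y \<in> J" if x: "x \<in> ?S" for x
    proof -
      have "\<exists>V\<in>\<U>. \<forall>y\<in>?S. stem y k = stem ((shift ^^ i) x) k \<longrightarrow> y \<in> V" for i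
        using k shift_avoiding_subshift[OF x] by blast
      then obtain V where V: "\<And>i. V i \<in> \<U>"
        "\<And>i y. y \<in> ?S \<Longrightarrow> stem y k = stem ((shift ^^ i) x) k \<Longrightarrow> y \<in> V i"
        by metis
      let ?W = "{y \<in> ?S. \<forall>i<n. (shift ^^ i) y \<in> V i}"
      have top: "topspace (subtopology full_shift ?S) = ?S" by simp
      have "?W \<in> ?J n" unfolding iterated_join_def top
        by (intro CollectI exI[of _ V] conjI allI impI refl V(1))
      moreover have "y \<in> ?W" if y: "y \<in> ?S" "stem y (n + k) = stem x (n + k)" for y
      proof -
        have "(shift ^^ i) y \<in> V i" if "i < n" for i
        proof (rule V(2))
          show "(shift ^^ i) y \<in> ?S" using y(1) by (rule shift_avoiding_subshift)
          have "take k (drop i (stem y (n + k))) = take k (drop i (stem x (n + k)))"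
            by (simp add: y(2))
          thus "stem ((shift ^^ i) y) k = stem ((shift ^^ i) x) k"
            using that by (simp add: drop_stem take_stem)
        qed
        thus ?thesis using y(1) by simp
      qed
      ultimately show ?thesis by blast
    qed
    hence "\<forall>w\<in>?R. \<exists>J\<in>?J n. \<forall>y\<in>?S. stem y (n + k) = w \<longrightarrow> y \<in> J" by blast
    then obtain c where c: "\<And>w. w \<in> ?R \<Longrightarrow> c w \<in> ?J n"
      "\<And>y. y \<in> ?S \<Longrightarrow> y \<in> c (stem y (n + k))"
      by (metis imageI)
    have R: "?R \<subseteq> avoiding_words F (n + k)"
      by (auto simp: avoiding_words_def avoiding_subshift_iff)
    hence "finite ?R" using finite_avoiding_words finite_subset by blast
    hence "card (c ` ?R) \<le> card (avoiding_words F (n + k))"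
      using card_image_le[of ?R c] card_mono[OF finite_avoiding_words R] by linarith
    moreover have "c ` ?R \<subseteq> ?J n" using c(1) by blast
    moreover have "?S \<subseteq> \<Union>(c ` ?R)" using c(2) by blast
    ultimately show ?thesis using \<open>finite ?R\<close> by blast
  qed
  thus ?thesis by (intro exI[of _ k] allI)
qed

lemma cover_number_le:
  assumes "\<V> \<subseteq> \<U>" "finite \<V>" "topspace X \<subseteq> \<Union>\<V>"
  shows "cover_number X \<U> \<le> card \<V>"
  unfolding cover_number_def using assms by (intro Least_le) blast

lemma cover_number_attained:
  assumes "\<V> \<subseteq> \<U>" "finite \<V>" "topspace X \<subseteq> \<Union>\<V>"
  shows "\<exists>\<V>\<subseteq>\<U>. finite \<V> \<and> topspace X \<subseteq> \<Union>\<V> \<and> card \<V> = cover_number X \<U>"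
  unfolding cover_number_def by (rule LeastI_ex) (use assms in blast)

text \<open>The bound on \<open>x\<close> matters when there are few avoiding words: the covering number may then be 0
  or 1, and the entropy is 0 rather than negative.\<close>
lemma shannon_capacity_le:
  assumes x: "0 < x" "x \<le> 1" and summ: "summable (\<lambda>n. real (card (avoiding_words F n)) * x ^ n)"
  shows "shannon_capacity F \<le> ereal (- ln x)"
  unfolding shannon_capacity_def topological_entropy_def
proof (rule SUP_least)
  fix \<U>
  let ?X = "subtopology full_shift (avoiding_subshift F)"
  let ?N = "\<lambda>n. cover_number ?X (iterated_join ?X shift \<U> n)"
  assume "\<U> \<in> {\<U>. open_cover ?X \<U>}"
  hence "open_cover ?X \<U>" by simp
  then obtain k where k: "\<forall>n. \<exists>\<V>\<subseteq>iterated_join ?X shift \<U> n.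
      finite \<V> \<and> avoiding_subshift F \<subseteq> \<Union>\<V> \<and> card \<V> \<le> card (avoiding_words F (n + k))"
    using iterated_join_subcover by (elim exE[OF iterated_join_subcover])
  have top: "topspace ?X = avoiding_subshift F" by simp
  have N: "?N n \<le> card (avoiding_words F (n + k))" for n
  proof -
    obtain \<V> where "\<V> \<subseteq> iterated_join ?X shift \<U> n" "finite \<V>" "avoiding_subshift F \<subseteq> \<Union>\<V>"
      "card \<V> \<le> card (avoiding_words F (n + k))"
      using k[rule_format, of n] by (elim exE conjE)
    thus ?thesis using cover_number_le[of \<V> "iterated_join ?X shift \<U> n" ?X] unfolding top
      by linarith
  qed
  obtain C where C: "1 \<le> C" "\<And>n. real (card (avoiding_words F n)) * x ^ n \<le> C"
  proof -
    have "Bseq (\<lambda>n. real (card (avoiding_words F n)) * x ^ n)"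
      using summ by (intro convergent_imp_Bseq) (auto simp: convergent_def dest: summable_LIMSEQ_zero)
    then obtain K where "\<And>n. norm (real (card (avoiding_words F n)) * x ^ n) \<le> K"
      by (auto simp: Bseq_def)
    thus thesis using x by (intro that[of "max 1 K"]) (auto simp: le_max_iff_disj)
  qed
  have lnx: "ln x \<le> 0" using x by simp
  have "ln (real (?N n)) / real n \<le> - ln x + (ln C - real k * ln x) / real n" if n: "n \<ge> 1" for n
  proof -
    have "ln (real (?N n)) \<le> ln C - real (n + k) * ln x"
    proof (cases "?N n = 0")
      case True
      have "real (n + k) * ln x \<le> 0" using lnx by (intro mult_nonneg_nonpos) auto
      moreover have "0 \<le> ln C" using C(1) by simp
      ultimately show ?thesis using True by simp
    next
      case False
      have "real (?N n) * x ^ (n + k) \<le> real (card (avoiding_words F (n + k))) * x ^ (n + k)"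
        using N x by (intro mult_right_mono) auto
      hence "real (?N n) * x ^ (n + k) \<le> C" using C(2) order_trans by blast
      hence "ln (real (?N n) * x ^ (n + k)) \<le> ln C"
        using False x C(1) by (subst ln_le_cancel_iff) auto
      thus ?thesis using False x by (simp add: ln_mult ln_realpow)
    qed
    also have "\<dots> = real n * (- ln x + (ln C - real k * ln x) / real n)"
      using n by (simp add: field_simps)
    finally show ?thesis
      using n by (intro mult_imp_div_pos_le) (simp, simp only: mult.commute)
  qed
  hence "eventually (\<lambda>n. ereal (ln (real (?N n)) / real n) \<le>
      ereal (- ln x + (ln C - real k * ln x) / real n)) sequentially"
    by (intro eventually_sequentiallyI[of 1]) simp
  hence "cover_entropy ?X shift \<U> \<le> limsup (\<lambda>n. ereal (- ln x + (ln C - real k * ln x) / real n))"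
    unfolding cover_entropy_def by (rule Limsup_mono)
  also have "(\<lambda>n. - ln x + (ln C - real k * ln x) / real n) \<longlonglongrightarrow> - ln x + 0"
    by (intro tendsto_intros lim_const_over_n)
  hence "limsup (\<lambda>n. ereal (- ln x + (ln C - real k * ln x) / real n)) = ereal (- ln x)"
    by (intro lim_imp_Limsup) auto
  finally show "cover_entropy ?X shift \<U> \<le> ereal (- ln x)" .
qed

text \<open>Not every avoiding word extends to an avoiding sequence, but by Koenig's lemma there is an \<open>N\<close> such that
  an avoiding word of length \<open>n\<close> that has an avoiding extension by \<open>N\<close> letters does. Cutting a word of length
  \<open>q * n + N\<close> into blocks of length \<open>n\<close>, each followed by at least \<open>N\<close> letters, bounds the number of avoiding
  words by \<open>e ^ q\<close> times a constant, \<open>e\<close> being the number of extensible words of length \<open>n\<close>; then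
  \<open>q\<close> tends to infinity.\<close>
lemma card_stems_ge:
  assumes "0 \<le> x" and ge: "\<And>n. 1 \<le> real (card (avoiding_words F n)) * x ^ n"
  shows "1 \<le> real (card ((\<lambda>y. stem y n) ` avoiding_subshift F)) * x ^ n"
proof -
  let ?R = "(\<lambda>y. stem y n) ` avoiding_subshift F"
  let ?a = "\<lambda>n. card (avoiding_words F n)"
  have sub: "?R \<subseteq> avoiding_words F n" by (auto simp: avoiding_words_def avoiding_subshift_iff)
  have fin: "finite ?R" using finite_subset[OF sub finite_avoiding_words] .
  have "\<exists>N. \<forall>v. length v = N \<longrightarrow> \<not> avoids F (w @ v)" if w: "w \<in> avoiding_words F n - ?R" for w
  proof (rule ccontr)
    assume "\<nexists>N. \<forall>v. length v = N \<longrightarrow> \<not> avoids F (w @ v)"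
    hence "\<exists>y. stem y (length w) = w \<and> (\<forall>n. avoids F (stem y n))"
      by (intro koenig) (auto dest: avoids_appendD)
    then obtain y where "stem y n = w" "y \<in> avoiding_subshift F"
      using w by (auto simp: avoiding_words_def avoiding_subshift_iff)
    thus False using w by blast
  qed
  then obtain L where L: "\<And>w v. w \<in> avoiding_words F n - ?R \<Longrightarrow> length v = L w \<Longrightarrow> \<not> avoids F (w @ v)"
    by metis
  define N where "N = Max (L ` avoiding_words F n)"
  have N: "L w \<le> N" if "w \<in> avoiding_words F n" for w
    unfolding N_def using that finite_avoiding_words by (intro Max_ge) auto
  have step: "?a (n + l) \<le> card ?R * ?a l" if l: "N \<le> l" for l
  proof (rule card_avoiding_words_add_le[OF fin])
    fix w assume w: "w \<in> avoiding_words F (n + l)"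
    hence tw: "take n w \<in> avoiding_words F n" by (auto simp: avoiding_words_def avoids_take)
    show "take n w \<in> ?R"
    proof (rule ccontr)
      let ?t = "take n w"
      assume "?t \<notin> ?R"
      moreover have "L ?t \<le> length (drop n w)" using N[OF tw] l w by (simp add: avoiding_words_def)
      ultimately have "\<not> avoids F (?t @ take (L ?t) (drop n w))"
        using tw by (intro L) auto
      moreover have "?t @ take (L ?t) (drop n w) = take (n + L ?t) w" by (simp add: take_add)
      ultimately show False using w by (auto simp: avoiding_words_def avoids_take)
    qed
  qed
  have pow: "?a (q * n + N) \<le> card ?R ^ q * ?a N" for q
  proof (induction q)
    case (Suc q)
    have "?a (Suc q * n + N) \<le> card ?R * ?a (q * n + N)"
      using step[of "q * n + N"] by (simp add: add.assoc)
    also have "\<dots> \<le> card ?R * (card ?R ^ q * ?a N)" using Suc by (intro mult_left_mono) auto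
    finally show ?case by (simp add: mult.assoc)
  qed simp
  show ?thesis
  proof (rule ccontr)
    let ?b = "real (card ?R) * x ^ n"
    let ?D = "real (?a N) * x ^ N"
    assume "\<not> 1 \<le> ?b"
    moreover have D: "0 < ?D" using ge[of N] by linarith
    ultimately obtain q where q: "?b ^ q < 1 / ?D"
      using real_arch_pow_inv[of "1 / ?D" ?b] by auto
    have "1 \<le> real (?a (q * n + N)) * x ^ (q * n + N)" by (rule ge)
    also have "\<dots> \<le> real (card ?R ^ q * ?a N) * x ^ (q * n + N)"
      using pow assms(1) by (intro mult_right_mono of_nat_mono) auto
    also have "\<dots> = ?b ^ q * ?D"
      by (simp add: power_add power_mult_distrib mult_ac flip: power_mult)
    also have "\<dots> < 1" using q D by (simp add: field_simps)
    finally show False by simp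
  qed
qed

text \<open>The partition by the first symbol suffices: its \<open>n\<close>-fold join separates the initial blocks of
  length \<open>n\<close>, so that a subcover has at least one member for each of them.\<close>
lemma shannon_capacity_ge:
  assumes x: "0 < x" and ge: "\<And>n. 1 \<le> real (card (avoiding_words F n)) * x ^ n"
  shows "ereal (- ln x) \<le> shannon_capacity F"
proof -
  let ?S = "avoiding_subshift F"
  let ?X = "subtopology full_shift ?S"
  define \<U> where "\<U> = (\<lambda>b. {y \<in> ?S. y 0 = b}) ` UNIV"
  let ?J = "iterated_join ?X shift \<U>"
  have cover: "open_cover ?X \<U>"
  proof -
    have "openin full_shift {y. y 0 = b}" for b :: bool
    proof -
      have "continuous_map full_shift (discrete_topology UNIV) (\<lambda>y. y (0::nat))"
        unfolding full_shift_def by (rule continuous_map_product_projection) simp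
      from openin_continuous_map_preimage[OF this, of "{b}"] show ?thesis by simp
    qed
    hence "openin ?X {y \<in> ?S. y 0 = b}" for b
      unfolding openin_subtopology by (intro exI[of _ "{y. y 0 = b}"]) auto
    thus ?thesis unfolding open_cover_def \<U>_def by auto
  qed
  have big: "card ((\<lambda>y. stem y n) ` ?S) \<le> cover_number ?X (?J n)" for n
  proof -
    obtain k where k: "\<forall>n. \<exists>\<V>\<subseteq>?J n. finite \<V> \<and> ?S \<subseteq> \<Union>\<V> \<and> card \<V> \<le> card (avoiding_words F (n + k))"
      using iterated_join_subcover[OF cover] ..
    obtain \<W> where W: "\<W> \<subseteq> ?J n" "finite \<W>" "?S \<subseteq> \<Union>\<W>"
      using k[rule_format, of n] by (elim exE conjE)
    have top: "topspace ?X = ?S" by simp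
    obtain \<V> where V: "\<V> \<subseteq> ?J n" "finite \<V>" "?S \<subseteq> \<Union>\<V>" "card \<V> = cover_number ?X (?J n)"
      using cover_number_attained[of \<W> "?J n" ?X] W unfolding top by blast
    have same: "stem y n = stem y' n" if V': "V \<in> ?J n" "y \<in> V" "y' \<in> V" for V y y'
    proof -
      obtain U where U: "V = {y \<in> ?S. \<forall>i<n. (shift ^^ i) y \<in> U i}" "\<forall>i<n. U i \<in> \<U>"
        using V'(1) unfolding iterated_join_def top by blast
      have nth: "(shift ^^ i) u 0 = u i" for i u
        by (induction i arbitrary: u) (auto simp: shift_def simp del: funpow.simps simp: funpow_Suc_right)
      have "y i = y' i" if i: "i < n" for i
      proof -
        have "U i \<in> \<U>" using U(2) i by blast
        then obtain b where b: "U i = {y \<in> ?S. y 0 = b}" unfolding \<U>_def by blast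
        have "(shift ^^ i) y \<in> U i" "(shift ^^ i) y' \<in> U i"
          using V'(2,3) i unfolding U(1) by blast+
        hence "(shift ^^ i) y 0 = b" "(shift ^^ i) y' 0 = b" unfolding b by blast+
        thus ?thesis by (simp add: nth)
      qed
      thus ?thesis by (simp add: stem_eq_iff)
    qed
    have "(\<lambda>y. stem y n) ` ?S \<subseteq> (\<lambda>V. stem (SOME y. y \<in> V) n) ` \<V>"
    proof
      fix w assume "w \<in> (\<lambda>y. stem y n) ` ?S"
      then obtain y V where y: "w = stem y n" "V \<in> \<V>" "y \<in> V" using V(3) by blast
      have some: "(SOME y. y \<in> V) \<in> V" using y(3) by (rule someI[of "\<lambda>y. y \<in> V"])
      have "V \<in> ?J n" using V(1) y(2) by (rule subsetD)
      hence "w = stem (SOME y. y \<in> V) n" unfolding y(1) using y(3) some by (rule same)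
      thus "w \<in> (\<lambda>V. stem (SOME y. y \<in> V) n) ` \<V>" using y(2) by (rule image_eqI)
    qed
    hence "card ((\<lambda>y. stem y n) ` ?S) \<le> card \<V>" by (rule surj_card_le[OF V(2)])
    thus ?thesis using V(4) by simp
  qed
  have "- ln x \<le> ln (real (cover_number ?X (?J n))) / real n" if n: "n \<ge> 1" for n
  proof -
    have "1 \<le> real (card ((\<lambda>y. stem y n) ` ?S)) * x ^ n"
      using x ge by (intro card_stems_ge) auto
    also have "\<dots> \<le> real (cover_number ?X (?J n)) * x ^ n"
      using big x by (intro mult_right_mono) auto
    finally have *: "1 \<le> real (cover_number ?X (?J n)) * x ^ n" .
    hence nz: "cover_number ?X (?J n) \<noteq> 0" by (metis mult_zero_left not_one_le_zero of_nat_0)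
    have "0 \<le> ln (real (cover_number ?X (?J n)) * x ^ n)" using * by (rule ln_ge_zero)
    hence "0 \<le> ln (real (cover_number ?X (?J n))) + real n * ln x"
      using nz x by (simp add: ln_mult ln_realpow)
    thus ?thesis using n by (simp add: field_simps)
  qed
  hence "ereal (- ln x) \<le> cover_entropy ?X shift \<U>"
    unfolding cover_entropy_def
    by (intro le_Limsup eventually_sequentiallyI[of 1]) auto
  also have "\<dots> \<le> shannon_capacity F"
    unfolding shannon_capacity_def topological_entropy_def using cover by (intro SUP_upper) simp
  finally show ?thesis .
qed

section \<open>Return weights and overlaps\<close>

lemma hitting_time_rec:
  "hitting_time Z u = (if shift u \<in> Z then 1 else eSuc (hitting_time Z (shift u)))"
proof (cases "shift u \<in> Z")
  case True
  hence "(LEAST j. j \<ge> 1 \<and> (shift ^^ j) u \<in> Z) = 1"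
    by (intro Least_equality) auto
  moreover have "\<exists>j\<ge>1. (shift ^^ j) u \<in> Z" using True by (intro exI[of _ 1]) simp
  ultimately show ?thesis using True by (simp add: hitting_time_def one_enat_def)
next
  case False
  have eq: "Suc j \<ge> 1 \<and> (shift ^^ Suc j) u \<in> Z \<longleftrightarrow> j \<ge> 1 \<and> (shift ^^ j) (shift u) \<in> Z" for j
    using False by (cases j) (auto simp add: funpow_Suc_right simp del: funpow.simps)
  show ?thesis
  proof (cases "\<exists>j\<ge>1. (shift ^^ j) u \<in> Z")
    case True
    then obtain j where j: "j \<ge> 1 \<and> (shift ^^ j) u \<in> Z" by blast
    hence "(LEAST j. j \<ge> 1 \<and> (shift ^^ j) u \<in> Z) =
        Suc (LEAST j. Suc j \<ge> 1 \<and> (shift ^^ Suc j) u \<in> Z)"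
      by (rule Least_Suc) simp
    moreover have "\<exists>j\<ge>1. (shift ^^ j) (shift u) \<in> Z"
      using j eq by (cases j) auto
    ultimately show ?thesis using True False unfolding hitting_time_def eq by (simp add: eSuc_enat)
  next
    case none: False
    hence "\<not> (\<exists>j\<ge>1. (shift ^^ j) (shift u) \<in> Z)" using eq by blast
    thus ?thesis using none False by (simp only: hitting_time_def if_False eSuc_infinity)
  qed
qed

text \<open>This is \<open>x ^ \<ell>\<close> for the first return time \<open>\<ell>\<close> to \<open>Z\<close>, with \<open>x ^ \<infinity> = 0\<close>; the asymptotic constant is obtained at
  \<open>x = 1/2\<close>.\<close>
definition return_weight :: "(nat \<Rightarrow> bool) set \<Rightarrow> real \<Rightarrow> (nat \<Rightarrow> bool) \<Rightarrow> real" where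
  "return_weight Z x u = (case hitting_time Z u of enat n \<Rightarrow> x ^ n | \<infinity> \<Rightarrow> 0)"

lemma return_weight_half: "return_weight Z (1/2) u = two_power_minus (hitting_time Z u)"
  by (cases "hitting_time Z u") (auto simp: return_weight_def power_one_over)

lemma return_weight_rec:
  "return_weight Z x u = (if shift u \<in> Z then x else x * return_weight Z x (shift u))"
  unfolding return_weight_def hitting_time_rec[of Z u]
  by (cases "hitting_time Z (shift u)") (auto simp: one_enat_def eSuc_enat)

lemma return_weight_bounds:
  "0 \<le> x \<Longrightarrow> x \<le> 1 \<Longrightarrow> 0 \<le> return_weight Z x u" "0 \<le> x \<Longrightarrow> x \<le> 1 \<Longrightarrow> return_weight Z x u \<le> 1"
  by (auto simp: return_weight_def power_le_one split: enat.splits)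

lemma isCont_return_weight: "isCont (\<lambda>x. return_weight Z x u) a"
  by (cases "hitting_time Z u") (auto simp: return_weight_def)

text \<open>Summing \<open>x ^ s - x ^ s'\<close> over consecutive visits \<open>s < s'\<close> of the orbit to \<open>Z\<close>. This identity is the
  reason why the weights \<open>1 - x ^ \<ell>\<close> appear in the limit.\<close>
lemma return_weight_telescope:
  assumes "w \<in> Z"
  shows "(\<Sum>s\<le>S. if (shift ^^ s) w \<in> Z then x ^ s * (1 - return_weight Z x ((shift ^^ s) w)) else 0)
    = 1 - x ^ S * return_weight Z x ((shift ^^ S) w)"
proof (induction S)
  case (Suc S)
  thus ?case
    using return_weight_rec[of Z x "(shift ^^ S) w"] by (auto simp: algebra_simps)
qed (use assms in simp)

text \<open>For bounded shifts, a long overlap of the initial blocks of two sequences can only come from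
  a coincidence of the shifted sequences.\<close>
lemma eventually_stem_eq_iff:
  assumes "finite I"
  shows "\<forall>\<^sub>F m in sequentially. \<forall>j\<in>I. \<forall>i\<in>I. \<forall>s\<in>{..S}.
    stem ((shift ^^ s) (z j)) (m - s) = stem (z i) (m - s) \<longleftrightarrow> (shift ^^ s) (z j) = z i"
proof (intro eventually_ball_finite assms finite_atMost ballI)
  fix j i s
  show "\<forall>\<^sub>F m in sequentially.
    stem ((shift ^^ s) (z j)) (m - s) = stem (z i) (m - s) \<longleftrightarrow> (shift ^^ s) (z j) = z i"
  proof (cases "(shift ^^ s) (z j) = z i")
    case False
    then obtain k where k: "(shift ^^ s) (z j) k \<noteq> z i k" by blast
    show ?thesis
    proof (rule eventually_sequentiallyI[of "Suc (k + s)"])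
      fix m assume "Suc (k + s) \<le> m"
      hence "k < m - s" by simp
      thus "stem ((shift ^^ s) (z j)) (m - s) = stem (z i) (m - s) \<longleftrightarrow> (shift ^^ s) (z j) = z i"
        using k by (auto simp: stem_eq_iff)
    qed
  qed simp
qed

lemma geometric_tail: "S \<le> m \<Longrightarrow> (\<Sum>s\<in>{S..<m}. (3/4::real) ^ s) \<le> 4 * (3/4) ^ S - 4 * (3/4) ^ m"
  by (induction m rule: dec_induct) auto

text \<open>With the weights \<open>1 - x ^ \<ell>\<close>, the columns of the overlap matrix sum to almost 1: the shifts up to \<open>S\<close> are
  actual visits of the orbit of \<open>z j\<close> to the finite set and telescope, and what is left
  is a geometric tail.\<close>
lemma weighted_overlap_bound:
  fixes z :: "'i \<Rightarrow> nat \<Rightarrow> bool" and x :: real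
  assumes I: "finite I" and inj: "inj_on z I" and x: "0 \<le> x" "x \<le> 3/4" and S: "S < m" and j: "j \<in> I"
    and match: "\<And>i s. i \<in> I \<Longrightarrow> s \<le> S \<Longrightarrow>
      stem ((shift ^^ s) (z j)) (m - s) = stem (z i) (m - s) \<longleftrightarrow> (shift ^^ s) (z j) = z i"
  shows "\<bar>(\<Sum>i\<in>I. (1 - return_weight (z ` I) x (z i)) * overlap (stem (z j) m) (stem (z i) m) x) - 1\<bar>
    \<le> (4 * card I + 1) * (3/4) ^ S"
proof -
  let ?y = "\<lambda>u. 1 - return_weight (z ` I) x u"
  have y: "0 \<le> ?y u" "?y u \<le> 1" for u
    using return_weight_bounds[of x "z ` I" u] x by auto
  define c where "c s = (\<Sum>i\<in>I. if stem ((shift ^^ s) (z j)) (m - s) = stem (z i) (m - s) then ?y (z i) else 0)" for s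
  have "(\<Sum>i\<in>I. ?y (z i) * overlap (stem (z j) m) (stem (z i) m) x) =
      (\<Sum>i\<in>I. \<Sum>s<m. ?y (z i) * (if stem ((shift ^^ s) (z j)) (m - s) = stem (z i) (m - s) then x ^ s else 0))"
    unfolding overlap_def sum_distrib_left by (simp add: drop_stem take_stem)
  also have "\<dots> = (\<Sum>s<m. x ^ s * c s)"
    unfolding c_def sum_distrib_left by (subst sum.swap) (intro sum.cong refl, simp)
  also have "\<dots> = (\<Sum>s\<le>S. x ^ s * c s) + (\<Sum>s\<in>{Suc S..<m}. x ^ s * c s)"
  proof -
    have split: "{..<m} = {..S} \<union> {Suc S..<m}" using S by auto
    show ?thesis unfolding split by (rule sum.union_disjoint) auto
  qed
  also have "(\<Sum>s\<le>S. x ^ s * c s) =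
      (\<Sum>s\<le>S. if (shift ^^ s) (z j) \<in> z ` I then x ^ s * ?y ((shift ^^ s) (z j)) else 0)"
  proof (intro sum.cong refl)
    fix s assume "s \<in> {..S}"
    hence c: "c s = (\<Sum>i\<in>I. if (shift ^^ s) (z j) = z i then ?y (z i) else 0)"
      unfolding c_def using match by (intro sum.cong refl) auto
    show "x ^ s * c s = (if (shift ^^ s) (z j) \<in> z ` I then x ^ s * ?y ((shift ^^ s) (z j)) else 0)"
    proof (cases "(shift ^^ s) (z j) \<in> z ` I")
      case True
      then obtain k where k: "k \<in> I" "(shift ^^ s) (z j) = z k" by blast
      have "c s = (\<Sum>i\<in>I. if i = k then ?y (z i) else 0)"
        unfolding c using k inj by (intro sum.cong refl) (auto simp: inj_on_def)
      thus ?thesis using k True I by simp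
    next
      case False
      hence "c s = 0" unfolding c by (intro sum.neutral) auto
      thus ?thesis using False by simp
    qed
  qed
  also have "\<dots> = 1 - x ^ S * return_weight (z ` I) x ((shift ^^ S) (z j))"
    using j by (intro return_weight_telescope) simp
  finally have eq: "(\<Sum>i\<in>I. ?y (z i) * overlap (stem (z j) m) (stem (z i) m) x) - 1 =
    (\<Sum>s\<in>{Suc S..<m}. x ^ s * c s) - x ^ S * return_weight (z ` I) x ((shift ^^ S) (z j))" by simp
  have c: "0 \<le> c s" "c s \<le> card I" for s
  proof -
    show "0 \<le> c s" unfolding c_def using y by (intro sum_nonneg) auto
    have "c s \<le> (\<Sum>i\<in>I. 1)" unfolding c_def using y by (intro sum_mono) auto
    thus "c s \<le> card I" by simp
  qed
  have pow: "x ^ s \<le> (3/4) ^ s" for s using x by (intro power_mono)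
  have "(\<Sum>s\<in>{Suc S..<m}. x ^ s * c s) \<le> (\<Sum>s\<in>{Suc S..<m}. (3/4) ^ s * card I)"
    using pow c x by (intro sum_mono mult_mono) auto
  also have "\<dots> = (\<Sum>s\<in>{Suc S..<m}. (3/4) ^ s) * card I" by (simp add: sum_distrib_right)
  also have "\<dots> \<le> (4 * (3/4) ^ S) * card I"
  proof (rule mult_right_mono)
    have "(\<Sum>s\<in>{Suc S..<m}. (3/4::real) ^ s) \<le> 4 * (3/4) ^ Suc S - 4 * (3/4) ^ m"
      using S by (intro geometric_tail) simp
    moreover have "(3/4::real) ^ Suc S \<le> (3/4) ^ S" by simp
    moreover have "0 \<le> (3/4::real) ^ m" by simp
    ultimately show "(\<Sum>s\<in>{Suc S..<m}. (3/4::real) ^ s) \<le> 4 * (3/4) ^ S" by linarith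
  qed simp
  finally have tail: "(\<Sum>s\<in>{Suc S..<m}. x ^ s * c s) \<le> 4 * card I * (3/4) ^ S" by (simp add: mult_ac)
  have tail0: "0 \<le> (\<Sum>s\<in>{Suc S..<m}. x ^ s * c s)" using c x by (intro sum_nonneg) auto
  have "x ^ S * return_weight (z ` I) x ((shift ^^ S) (z j)) \<le> (3/4) ^ S * 1"
    using pow x return_weight_bounds by (intro mult_mono) auto
  moreover have "0 \<le> x ^ S * return_weight (z ` I) x ((shift ^^ S) (z j))"
    using x return_weight_bounds by (intro mult_nonneg_nonneg) auto
  moreover have "0 \<le> real (4 * card I) * (3/4) ^ S" by simp
  ultimately show ?thesis unfolding eq using tail tail0 by (simp add: algebra_simps abs_le_iff)
qed

lemma eventually_weighted_overlap:
  fixes z :: "'i \<Rightarrow> nat \<Rightarrow> bool"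
  assumes I: "finite I" and inj: "inj_on z I" and \<delta>: "0 < \<delta>"
  shows "\<forall>\<^sub>F m in sequentially. \<forall>x\<in>{0..3/4}. \<forall>j\<in>I.
    \<bar>(\<Sum>i\<in>I. (1 - return_weight (z ` I) x (z i)) * overlap (stem (z j) m) (stem (z i) m) x) - 1\<bar> \<le> \<delta>"
proof -
  have "(\<lambda>S. (4 * card I + 1) * (3/4::real) ^ S) \<longlonglongrightarrow> real (4 * card I + 1) * (0 :: real)"
    by (intro tendsto_mult tendsto_const LIMSEQ_realpow_zero) auto
  hence "\<forall>\<^sub>F S in sequentially. (4 * card I + 1) * (3/4::real) ^ S < \<delta>"
    using \<delta> by (intro order_tendstoD) auto
  then obtain S where S: "(4 * card I + 1) * (3/4::real) ^ S < \<delta>"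
    using eventually_happens by force
  show ?thesis
    using eventually_stem_eq_iff[OF I, of S z] eventually_gt_at_top[of S]
  proof eventually_elim
    case (elim m)
    show ?case
    proof (intro ballI)
      fix x :: real and j assume "x \<in> {0..3/4}" "j \<in> I"
      thus "\<bar>(\<Sum>i\<in>I. (1 - return_weight (z ` I) x (z i)) * overlap (stem (z j) m) (stem (z i) m) x) - 1\<bar> \<le> \<delta>"
        using weighted_overlap_bound[OF I inj, of x S m j] elim S by fastforce
    qed
  qed
qed

section \<open>The radius of convergence\<close>

lemma overlap_nonneg: "0 \<le> x \<Longrightarrow> 0 \<le> overlap v u x"
  unfolding overlap_def by (intro sum_nonneg) auto

lemma overlap_self_ge_1:
  assumes "0 \<le> x" "u \<noteq> []" shows "1 \<le> overlap u u x"
proof -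
  have "(\<Sum>s\<in>{0}. if drop s u = take (length u - s) u then x ^ s else 0) \<le> overlap u u x"
    unfolding overlap_def using assms by (intro sum_mono2) auto
  thus ?thesis by simp
qed

text \<open>Since the diagonal overlaps are at least 1, each equation bounds its own unknown by \<open>x ^ m\<close>.
  This rough bound is what forces the radius of convergence towards \<open>1/2\<close>.\<close>
lemma sum_le_card_times_power:
  fixes x :: real
  assumes fin: "finite F" and ne: "[] \<notin> F" and x: "0 \<le> x" and \<phi>: "\<And>u. 0 \<le> \<phi> u"
    and eq: "\<And>u. u \<in> F \<Longrightarrow> x ^ m = (\<Sum>v\<in>F. overlap v u x * \<phi> v)"
  shows "(\<Sum>u\<in>F. \<phi> u) \<le> card F * x ^ m"
proof -
  have "\<phi> u \<le> x ^ m" if u: "u \<in> F" for u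
  proof -
    have "u \<noteq> []" using u ne by blast
    hence "1 * \<phi> u \<le> overlap u u x * \<phi> u"
      using overlap_self_ge_1[OF x] \<phi> by (intro mult_right_mono) auto
    also have "\<dots> \<le> (\<Sum>v\<in>F. overlap v u x * \<phi> v)"
      using fin u \<phi> overlap_nonneg[OF x] by (intro member_le_sum) auto
    finally show ?thesis using eq[OF u] by simp
  qed
  hence "(\<Sum>u\<in>F. \<phi> u) \<le> (\<Sum>u\<in>F. x ^ m)" by (intro sum_mono)
  thus ?thesis by simp
qed

lemma summable_words_mono:
  fixes x x' :: real
  assumes "summable (\<lambda>n. real (card (avoiding_words F n)) * x' ^ n)" "0 \<le> x" "x \<le> x'"
  shows "summable (\<lambda>n. real (card (avoiding_words F n)) * x ^ n)"
  using assms(1)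
  by (rule summable_comparison_test'[of _ 0]) (use assms in \<open>auto intro!: mult_left_mono power_mono\<close>)

lemma summable_words_below_half:
  fixes x :: real
  assumes "0 \<le> x" "x < 1/2"
  shows "summable (\<lambda>n. real (card (avoiding_words F n)) * x ^ n)"
proof (rule summable_comparison_test'[of "\<lambda>n. (2 * x) ^ n" 0])
  show "summable (\<lambda>n. (2 * x) ^ n)" using assms by (intro summable_geometric) auto
  fix n
  have "card (avoiding_words F n) \<le> card {w :: bool list. length w = n}"
    by (intro card_mono finite_words) (auto simp: avoiding_words_def)
  also have "\<dots> = 2 ^ n" using card_lists_length_eq[of "UNIV :: bool set" n] by simp
  finally have "real (card (avoiding_words F n)) \<le> 2 ^ n"
    by (metis of_nat_le_iff of_nat_numeral of_nat_power)
  hence "real (card (avoiding_words F n)) * x ^ n \<le> 2 ^ n * x ^ n"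
    using assms by (intro mult_right_mono) auto
  thus "norm (real (card (avoiding_words F n)) * x ^ n) \<le> (2 * x) ^ n"
    using assms by (simp add: power_mult_distrib)
qed

text \<open>The linear system at a point \<open>x\<close> below the radius of convergence \<open>R\<close>, where the reciprocal of the
  generating function of the avoiding words has been estimated by \<open>1 - x / R\<close>.\<close>
definition first_hit_masses ::
  "bool list set \<Rightarrow> nat \<Rightarrow> real \<Rightarrow> real \<Rightarrow> (bool list \<Rightarrow> real) \<Rightarrow> bool" where
  "first_hit_masses F m R x \<phi> \<longleftrightarrow> (\<forall>u. 0 \<le> \<phi> u) \<and> 2 * x - 1 \<le> (\<Sum>u\<in>F. \<phi> u) \<and>
    (\<Sum>u\<in>F. \<phi> u) \<le> 2 * x - 1 + (1 - x / R) \<and>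
    (\<forall>u\<in>F. x ^ m = (\<Sum>v\<in>F. overlap v u x * \<phi> v))"

text \<open>The entropy is \<open>- ln R\<close> for the radius of convergence \<open>R\<close> of the generating function of the
  avoiding words. By submultiplicativity the coefficients are at least \<open>R powr (- n)\<close>, so that the function
  is at least \<open>1 / (1 - x / R)\<close> and its reciprocal vanishes at \<open>R\<close>. The smallness assumption excludes
  convergence at \<open>3/4\<close>.\<close>
lemma capacity_radius:
  assumes fin: "finite F" and len: "\<And>u. u \<in> F \<Longrightarrow> length u = m" and m: "1 \<le> m"
    and small: "card F * (3/4) ^ m < (1/2 :: real)"
  obtains R where "1/2 \<le> R" "R \<le> 3/4" "shannon_capacity F = ereal (- ln R)"
    "\<forall>x. 0 < x \<longrightarrow> x < R \<longrightarrow> (\<exists>\<phi>. first_hit_masses F m R x \<phi>)"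
proof -
  let ?t = "\<lambda>x n. real (card (avoiding_words F n)) * x ^ n"
  have ne: "[] \<notin> F" using len m by fastforce
  have no: "\<not> summable (?t (3/4))"
  proof
    assume s: "summable (?t (3/4))"
    obtain \<phi> where \<phi>: "\<And>u. 0 \<le> \<phi> u" "(\<Sum>u\<in>F. \<phi> u) = 2 * (3/4) - 1 + 1 / (\<Sum>n. ?t (3/4) n)"
      "\<And>u. u \<in> F \<Longrightarrow> (3/4) ^ m = (\<Sum>v\<in>F. overlap v u (3/4) * \<phi> v)"
      using generating_function_equations[OF fin len m _ s] by auto
    have "0 \<le> 1 / (\<Sum>n. ?t (3/4) n)" using s by (simp add: suminf_nonneg)
    moreover have "(\<Sum>u\<in>F. \<phi> u) \<le> card F * (3/4) ^ m"
      using \<phi> by (intro sum_le_card_times_power[OF fin ne]) auto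
    ultimately show False using \<phi>(2) small by linarith
  qed
  define X where "X = {x. 0 \<le> x \<and> summable (?t x)}"
  have ub: "x \<le> 3/4" if "x \<in> X" for x
  proof (rule ccontr)
    assume "\<not> x \<le> 3/4"
    hence "summable (?t (3/4))" using that summable_words_mono[of F x "3/4"] by (auto simp: X_def)
    thus False using no by blast
  qed
  hence bdd: "bdd_above X" by (intro bdd_aboveI)
  have X0: "0 \<in> X" using summable_words_below_half[of 0 F] by (simp add: X_def)
  define R where "R = Sup X"
  have below: "summable (?t x)" if "0 < x" "x < R" for x
  proof -
    obtain x' where "x' \<in> X" "x < x'"
      using less_cSup_iff[OF _ bdd, of x] X0 \<open>x < R\<close> unfolding R_def by blast
    thus ?thesis using that summable_words_mono[of F x' x] by (auto simp: X_def)
  qed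
  have above: "1 \<le> ?t x n" if "R < x" "0 \<le> x" for x n
  proof (rule ge_1_if_not_summable[OF \<open>0 \<le> x\<close>])
    show "\<not> summable (?t x)"
      using that cSup_upper[OF _ bdd, of x] by (auto simp: X_def R_def)
  qed
  have half: "1/2 \<le> R"
  proof (rule dense_le)
    show "x \<le> R" if "x < 1/2" for x
    proof (cases "0 \<le> x")
      case True
      hence "x \<in> X" using summable_words_below_half that by (simp add: X_def)
      thus ?thesis unfolding R_def by (rule cSup_upper[OF _ bdd])
    next
      case False
      thus ?thesis using cSup_upper[OF X0 bdd] by (simp add: R_def)
    qed
  qed
  have R34: "R \<le> 3/4" unfolding R_def using X0 ub by (intro cSup_least) auto
  have at: "1 \<le> ?t R n" for n
  proof (rule tendsto_lowerbound[where F = "at_right R" and f = "\<lambda>x. ?t x n"])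
    show "((\<lambda>x. ?t x n) \<longlongrightarrow> ?t R n) (at_right R)" by (intro tendsto_intros)
    show "\<forall>\<^sub>F x in at_right R. 1 \<le> ?t x n"
      using eventually_at_right_less[of R]
      by eventually_elim (use above half in auto)
  qed simp
  have cap: "shannon_capacity F = ereal (- ln R)"
  proof (rule antisym)
    show "ereal (- ln R) \<le> shannon_capacity F"
      using half at by (intro shannon_capacity_ge) auto
    show "shannon_capacity F \<le> ereal (- ln R)"
    proof (rule tendsto_lowerbound[where F = "at_left R" and f = "\<lambda>x. ereal (- ln x)"])
      show "((\<lambda>x. ereal (- ln x)) \<longlongrightarrow> ereal (- ln R)) (at_left R)"
        using half by (intro tendsto_intros) auto
      have "\<forall>\<^sub>F x in at_left R. x \<in> {0<..<R}"
        using half by (intro eventually_at_leftI[of 0]) auto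
      thus "\<forall>\<^sub>F x in at_left R. shannon_capacity F \<le> ereal (- ln x)"
        by eventually_elim (use below R34 in \<open>intro shannon_capacity_le; force\<close>)
    qed simp
  qed
  show thesis
  proof (rule that[OF half R34 cap], intro allI impI)
    fix x assume x: "0 < x" "x < R"
    let ?A = "\<Sum>n. ?t x n"
    have s: "summable (?t x)" using x by (rule below)
    obtain \<phi> where \<phi>: "\<And>u. 0 \<le> \<phi> u" "(\<Sum>u\<in>F. \<phi> u) = 2 * x - 1 + 1 / ?A"
      "\<And>u. u \<in> F \<Longrightarrow> x ^ m = (\<Sum>v\<in>F. overlap v u x * \<phi> v)"
      using generating_function_equations[OF fin len m _ s] x by auto
    have q: "\<bar>x / R\<bar> < 1" using x by simp
    have "1 / (1 - x / R) = (\<Sum>n. (x / R) ^ n)" using suminf_geometric[of "x / R"] q by simp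
    also have "\<dots> \<le> ?A"
    proof (rule suminf_le[OF _ _ s])
      show "summable (\<lambda>n. (x / R) ^ n)" using q by (intro summable_geometric) simp
      fix n
      have "(x / R) ^ n * 1 \<le> (x / R) ^ n * ?t R n" using at x half by (intro mult_left_mono) auto
      also have "\<dots> = ?t x n" using x half by (simp add: power_divide)
      finally show "(x / R) ^ n \<le> ?t x n" by simp
    qed
    finally have A: "1 / (1 - x / R) \<le> ?A" .
    have pos: "0 < 1 - x / R" using x by (simp add: field_simps)
    hence "0 < 1 / (1 - x / R)" by simp
    hence "0 < ?A" using A by linarith
    moreover have "1 / ?A \<le> 1 - x / R"
      using A pos \<open>0 < ?A\<close> by (simp add: divide_simps mult.commute split: if_splits)
    ultimately show "\<exists>\<phi>. first_hit_masses F m R x \<phi>"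
      using \<phi> by (intro exI[of _ \<phi>]) (simp add: first_hit_masses_def)
  qed
qed

text \<open>Multiplying the equation of \<open>u\<close> by \<open>y u\<close> and summing, the left-hand sides give the total weight
  times \<open>x ^ m\<close>, while by the column sums the right-hand sides give nearly the sum of the unknowns, which is nearly
  \<open>2 * x - 1\<close>. The remaining error \<open>1 - x / R\<close> disappears as \<open>x\<close> tends to \<open>R\<close> from the left.\<close>
lemma radius_equation_approx:
  fixes R :: real and y :: "bool list \<Rightarrow> real \<Rightarrow> real"
  assumes fin: "finite F" and R: "0 < R" "R \<le> 3/4"
    and ex: "\<And>x. 0 < x \<Longrightarrow> x < R \<Longrightarrow> \<exists>\<phi>. first_hit_masses F m R x \<phi>"
    and cont: "\<And>u. isCont (y u) R" and \<delta>: "0 \<le> \<delta>" "\<delta> \<le> 1"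
    and approx: "\<And>x v. 0 \<le> x \<Longrightarrow> x \<le> 3/4 \<Longrightarrow> v \<in> F \<Longrightarrow>
      \<bar>(\<Sum>u\<in>F. y u x * overlap v u x) - 1\<bar> \<le> \<delta>"
  shows "(1 - \<delta>) * (2 * R - 1) \<le> (\<Sum>u\<in>F. y u R) * R ^ m"
    and "(\<Sum>u\<in>F. y u R) * R ^ m \<le> (1 + \<delta>) * (2 * R - 1)"
proof -
  have ineq: "(1 - \<delta>) * (2 * x - 1) \<le> (\<Sum>u\<in>F. y u x) * x ^ m \<and>
      (\<Sum>u\<in>F. y u x) * x ^ m \<le> (1 + \<delta>) * (2 * x - 1 + (1 - x / R))" if x: "0 < x" "x < R" for x
  proof -
    obtain \<phi> where \<phi>: "\<And>u. 0 \<le> \<phi> u" "2 * x - 1 \<le> (\<Sum>u\<in>F. \<phi> u)"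
      "(\<Sum>u\<in>F. \<phi> u) \<le> 2 * x - 1 + (1 - x / R)"
      "\<And>u. u \<in> F \<Longrightarrow> x ^ m = (\<Sum>v\<in>F. overlap v u x * \<phi> v)"
      using ex[OF x] unfolding first_hit_masses_def by blast
    let ?E = "\<lambda>v. \<Sum>u\<in>F. y u x * overlap v u x"
    have "(\<Sum>u\<in>F. y u x) * x ^ m = (\<Sum>u\<in>F. y u x * (\<Sum>v\<in>F. overlap v u x * \<phi> v))"
      unfolding sum_distrib_right using \<phi>(4) by (intro sum.cong refl) simp
    also have "\<dots> = (\<Sum>v\<in>F. ?E v * \<phi> v)"
      unfolding sum_distrib_left sum_distrib_right by (subst sum.swap) (simp add: mult.assoc)
    finally have eq: "(\<Sum>u\<in>F. y u x) * x ^ m = (\<Sum>v\<in>F. ?E v * \<phi> v)" .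
    have E: "1 - \<delta> \<le> ?E v" "?E v \<le> 1 + \<delta>" if "v \<in> F" for v
      using approx[of x v] that x R by (auto simp: abs_le_iff)
    have "(1 - \<delta>) * (2 * x - 1) \<le> (1 - \<delta>) * (\<Sum>v\<in>F. \<phi> v)"
      using \<phi>(2) \<delta> by (intro mult_left_mono) auto
    also have "\<dots> \<le> (\<Sum>v\<in>F. ?E v * \<phi> v)"
      unfolding sum_distrib_left using E \<phi>(1) by (intro sum_mono mult_right_mono) auto
    finally have lo: "(1 - \<delta>) * (2 * x - 1) \<le> (\<Sum>v\<in>F. ?E v * \<phi> v)" .
    have "(\<Sum>v\<in>F. ?E v * \<phi> v) \<le> (1 + \<delta>) * (\<Sum>v\<in>F. \<phi> v)"
      unfolding sum_distrib_left using E \<phi>(1) by (intro sum_mono mult_right_mono) auto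
    also have "\<dots> \<le> (1 + \<delta>) * (2 * x - 1 + (1 - x / R))"
      using \<phi>(3) \<delta> by (intro mult_left_mono) auto
    finally show ?thesis using lo eq by simp
  qed
  have ev: "\<forall>\<^sub>F x in at_left R. x \<in> {0<..<R}"
    using R by (intro eventually_at_leftI[of 0]) auto
  have lim: "((\<lambda>x. (\<Sum>u\<in>F. y u x) * x ^ m) \<longlongrightarrow> (\<Sum>u\<in>F. y u R) * R ^ m) (at_left R)"
  proof -
    have "(y u \<longlongrightarrow> y u R) (at_left R)" for u
      using cont[of u] unfolding isCont_def by (rule tendsto_within_subset) simp
    thus ?thesis by (intro tendsto_intros)
  qed
  show "(1 - \<delta>) * (2 * R - 1) \<le> (\<Sum>u\<in>F. y u R) * R ^ m"
  proof (rule tendsto_le[OF _ lim])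
    show "((\<lambda>x. (1 - \<delta>) * (2 * x - 1)) \<longlongrightarrow> (1 - \<delta>) * (2 * R - 1)) (at_left R)"
      by (intro tendsto_intros)
    show "\<forall>\<^sub>F x in at_left R. (1 - \<delta>) * (2 * x - 1) \<le> (\<Sum>u\<in>F. y u x) * x ^ m"
      using ev by eventually_elim (use ineq in auto)
  qed simp
  show "(\<Sum>u\<in>F. y u R) * R ^ m \<le> (1 + \<delta>) * (2 * R - 1)"
  proof (rule tendsto_le[OF _ _ lim])
    have "((\<lambda>x. (1 + \<delta>) * (2 * x - 1 + (1 - x / R))) \<longlongrightarrow> (1 + \<delta>) * (2 * R - 1 + (1 - R / R))) (at_left R)"
      using R by (intro tendsto_intros) auto
    thus "((\<lambda>x. (1 + \<delta>) * (2 * x - 1 + (1 - x / R))) \<longlongrightarrow> (1 + \<delta>) * (2 * R - 1)) (at_left R)"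
      using R by simp
    show "\<forall>\<^sub>F x in at_left R. (\<Sum>u\<in>F. y u x) * x ^ m \<le> (1 + \<delta>) * (2 * x - 1 + (1 - x / R))"
      using ev by eventually_elim (use ineq in auto)
  qed simp
qed

section \<open>Asymptotics\<close>

text \<open>With \<open>t = 2 * R - 1\<close>, the rough bound makes \<open>t\<close> exponentially small in \<open>m\<close>, hence \<open>(2 * R) ^ m\<close> tends to 1
  and the approximate equation gives \<open>2 ^ m * t \<longlonglongrightarrow> Y (1/2)\<close>. Finally \<open>ln 2 + ln R = ln (1 + t)\<close> is
  asymptotic to \<open>t\<close>.\<close>
lemma radius_asymptotics:
  fixes R :: "nat \<Rightarrow> real" and Y :: "real \<Rightarrow> real" and p :: real
  assumes R: "\<forall>\<^sub>F m in sequentially. 1/2 \<le> R m \<and> R m \<le> 3/4"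
    and close: "\<forall>\<^sub>F m in sequentially. 2 * R m - 1 \<le> p * R m ^ m"
    and cont: "isCont Y (1/2)" and p: "0 \<le> p"
    and approx: "\<And>\<delta>. 0 < \<delta> \<Longrightarrow> \<delta> \<le> 1 \<Longrightarrow> \<forall>\<^sub>F m in sequentially.
      (1 - \<delta>) * (2 * R m - 1) \<le> Y (R m) * R m ^ m \<and> Y (R m) * R m ^ m \<le> (1 + \<delta>) * (2 * R m - 1)"
  shows "(\<lambda>m. 2 ^ m * (ln 2 + ln (R m))) \<longlonglongrightarrow> Y (1/2)"
proof -
  define t where "t m = 2 * R m - 1" for m
  define U where "U m = 2 ^ m * t m" for m
  define V where "V m = Y (R m) * (1 + t m) ^ m" for m
  have scale: "2 ^ m * R m ^ m = (1 + t m) ^ m" for m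
  proof -
    have "1 + t m = 2 * R m" by (simp add: t_def)
    thus ?thesis by (simp only: power_mult_distrib)
  qed
  have t: "\<forall>\<^sub>F m in sequentially. 0 \<le> t m \<and> t m \<le> 1/2 \<and> t m \<le> p * (3/4) ^ m"
    using R close
  proof eventually_elim
    case (elim m)
    have "p * R m ^ m \<le> p * (3/4) ^ m" using elim p by (intro mult_left_mono power_mono) auto
    thus ?case using elim by (simp add: t_def)
  qed
  have t0: "t \<longlonglongrightarrow> 0"
  proof (rule tendsto_sandwich)
    show "\<forall>\<^sub>F m in sequentially. 0 \<le> t m" using t by eventually_elim simp
    show "\<forall>\<^sub>F m in sequentially. t m \<le> p * (3/4) ^ m" using t by eventually_elim simp
    show "(\<lambda>m. p * (3/4) ^ m) \<longlonglongrightarrow> 0" by real_asymp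
  qed simp
  have pow1: "(\<lambda>m. (1 + t m) ^ m) \<longlonglongrightarrow> 1"
  proof (rule tendsto_sandwich)
    show "\<forall>\<^sub>F m in sequentially. 1 \<le> (1 + t m) ^ m"
      using t by eventually_elim (auto intro: one_le_power)
    show "\<forall>\<^sub>F m in sequentially. (1 + t m) ^ m \<le> exp (real m * (p * (3/4) ^ m))"
      using t
    proof eventually_elim
      case (elim m)
      have "(1 + t m) ^ m \<le> exp (t m) ^ m" using elim by (intro power_mono exp_ge_add_one_self) auto
      also have "\<dots> = exp (real m * t m)" by (simp add: exp_of_nat_mult)
      also have "\<dots> \<le> exp (real m * (p * (3/4) ^ m))" using elim by (simp add: mult_left_mono)
      finally show ?case .
    qed
    show "(\<lambda>m. exp (real m * (p * (3/4) ^ m))) \<longlonglongrightarrow> 1" by real_asymp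
  qed simp
  have R_half: "R \<longlonglongrightarrow> 1/2"
  proof -
    have "(\<lambda>m. (1 + t m) / 2) \<longlonglongrightarrow> (1 + 0) / 2" using t0 by (intro tendsto_intros) auto
    thus ?thesis by (simp add: t_def)
  qed
  have V: "V \<longlonglongrightarrow> Y (1/2)"
  proof -
    have "(\<lambda>m. Y (R m)) \<longlonglongrightarrow> Y (1/2)" using cont R_half by (rule isCont_tendsto_compose)
    from tendsto_mult[OF this pow1] show ?thesis by (simp add: V_def[abs_def])
  qed
  have U_bound: "\<forall>\<^sub>F m in sequentially. 0 \<le> U m \<and> U m \<le> 2 * p"
  proof -
    have "\<forall>\<^sub>F m in sequentially. (1 + t m) ^ m < 2" using pow1 by (rule order_tendstoD) simp
    with t close show ?thesis
    proof eventually_elim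
      case (elim m)
      have "U m \<le> 2 ^ m * (p * R m ^ m)" using elim by (simp add: U_def t_def)
      also have "\<dots> = p * (1 + t m) ^ m" by (simp add: mult_ac flip: scale)
      also have "\<dots> \<le> p * 2" using elim p by (intro mult_left_mono) auto
      finally show ?case using elim by (simp add: U_def)
    qed
  qed
  have "(\<lambda>m. V m - U m) \<longlonglongrightarrow> 0"
  proof (rule LIMSEQ_I)
    fix e :: real assume e: "0 < e"
    \<comment> \<open>the bound \<open>2 * p\<close> for \<open>U\<close> turns a relative error \<open>\<delta>\<close> into an absolute error below \<open>e\<close>\<close>
    define \<delta> where "\<delta> = min 1 (e / (2 * p + 1))"
    have \<delta>: "0 < \<delta>" "\<delta> \<le> 1" using e p by (auto simp: \<delta>_def)
    have "\<delta> * (2 * p) < e"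
    proof -
      have "\<delta> * (2 * p) < \<delta> * (2 * p + 1)" using \<delta> by simp
      also have "\<dots> \<le> e / (2 * p + 1) * (2 * p + 1)" using p by (intro mult_right_mono) (auto simp: \<delta>_def)
      also have "\<dots> = e" using p by simp
      finally show ?thesis .
    qed
    note small = this
    have "\<forall>\<^sub>F m in sequentially. norm (V m - U m - 0) < e"
      using approx[OF \<delta>] U_bound
    proof eventually_elim
      case (elim m)
      have "V m = 2 ^ m * (Y (R m) * R m ^ m)" by (simp add: V_def mult_ac flip: scale)
      moreover have "2 ^ m * ((1 - \<delta>) * (2 * R m - 1)) \<le> 2 ^ m * (Y (R m) * R m ^ m)"
        "2 ^ m * (Y (R m) * R m ^ m) \<le> 2 ^ m * ((1 + \<delta>) * (2 * R m - 1))"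
        using elim by (auto intro: mult_left_mono)
      moreover have "2 ^ m * ((1 - \<delta>) * (2 * R m - 1)) = U m - \<delta> * U m"
        "2 ^ m * ((1 + \<delta>) * (2 * R m - 1)) = U m + \<delta> * U m"
        by (simp_all add: U_def t_def algebra_simps)
      ultimately have "\<bar>V m - U m\<bar> \<le> \<delta> * U m" by linarith
      also have "\<dots> \<le> \<delta> * (2 * p)" using elim \<delta> by (intro mult_left_mono) auto
      finally show ?case using small by simp
    qed
    thus "\<exists>no. \<forall>m\<ge>no. norm (V m - U m - 0) < e" by (simp add: eventually_sequentially)
  qed
  from tendsto_diff[OF V this] have U: "U \<longlonglongrightarrow> Y (1/2)" by simp
  show ?thesis
  proof (rule tendsto_sandwich)
    show "(\<lambda>m. U m * (1 - t m)) \<longlonglongrightarrow> Y (1/2)"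
      using tendsto_mult[OF U tendsto_diff[OF tendsto_const[of 1] t0]] by simp
    have ln: "ln 2 + ln (R m) = ln (1 + t m)" if "1/2 \<le> R m" for m
      using that by (simp add: t_def ln_mult)
    show "\<forall>\<^sub>F m in sequentially. U m * (1 - t m) \<le> 2 ^ m * (ln 2 + ln (R m))"
      using t R
    proof eventually_elim
      case (elim m)
      have "t m - (t m)\<^sup>2 \<le> ln (1 + t m)" using elim by (intro ln_one_plus_pos_lower_bound) auto
      hence "2 ^ m * (t m - (t m)\<^sup>2) \<le> 2 ^ m * ln (1 + t m)" by (intro mult_left_mono) auto
      thus ?case using ln elim by (simp add: U_def power2_eq_square algebra_simps)
    qed
    show "\<forall>\<^sub>F m in sequentially. 2 ^ m * (ln 2 + ln (R m)) \<le> U m"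
      using t R
    proof eventually_elim
      case (elim m)
      have "ln (1 + t m) \<le> t m" using elim by (intro ln_add_one_self_le_self) auto
      thus ?case using ln elim by (simp add: U_def)
    qed
  qed (rule U)
qed

text \<open>The radius is chosen once for each \<open>m\<close>, before the accuracy \<open>\<delta>\<close>, so that one sequence of radii
  satisfies the approximate equation for all \<open>\<delta>\<close>.\<close>
lemma eventually_capacity_radius:
  fixes z :: "'i \<Rightarrow> nat \<Rightarrow> bool" and I :: "'i set"
  defines "Y \<equiv> \<lambda>x. \<Sum>i\<in>I. 1 - return_weight (z ` I) x (z i)"
  assumes I: "finite I" and inj: "inj_on z I"
  obtains R :: "nat \<Rightarrow> real" where
    "\<forall>\<^sub>F m in sequentially. shannon_capacity ((\<lambda>i. stem (z i) m) ` I) = ereal (- ln (R m))"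
    "\<forall>\<^sub>F m in sequentially. 1/2 \<le> R m \<and> R m \<le> 3/4"
    "\<forall>\<^sub>F m in sequentially. 2 * R m - 1 \<le> card I * R m ^ m"
    "\<forall>\<delta>. 0 < \<delta> \<longrightarrow> \<delta> \<le> 1 \<longrightarrow> (\<forall>\<^sub>F m in sequentially.
      (1 - \<delta>) * (2 * R m - 1) \<le> Y (R m) * R m ^ m \<and> Y (R m) * R m ^ m \<le> (1 + \<delta>) * (2 * R m - 1))"
proof -
  let ?F = "\<lambda>m. (\<lambda>i. stem (z i) m) ` I"
  define good where "good m R \<longleftrightarrow> 1/2 \<le> R \<and> R \<le> 3/4 \<and>
    shannon_capacity (?F m) = ereal (- ln R) \<and>
    (\<forall>x. 0 < x \<longrightarrow> x < R \<longrightarrow> (\<exists>\<phi>. first_hit_masses (?F m) m R x \<phi>))" for m R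
  define R where "R m = (SOME r. good m r)" for m
  have "(\<lambda>m. card I * (3/4::real) ^ m) \<longlonglongrightarrow> 0" by real_asymp
  hence small: "\<forall>\<^sub>F m in sequentially. card I * (3/4::real) ^ m < 1/2"
    by (rule order_tendstoD) simp
  have good: "\<forall>\<^sub>F m in sequentially. 1 \<le> m \<and> good m (R m)"
    using small eventually_ge_at_top[of 1]
  proof eventually_elim
    case (elim m)
    have "card (?F m) \<le> card I" using I by (rule card_image_le)
    hence "card (?F m) * (3/4) ^ m \<le> card I * (3/4::real) ^ m" by (intro mult_right_mono) auto
    hence "card (?F m) * (3/4) ^ m < (1/2::real)" using elim by linarith
    then obtain r where "good m r"
    proof -
      have fin: "finite (?F m)" using I by simp
      have len: "length u = m" if "u \<in> ?F m" for u using that by auto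
      obtain r where "1/2 \<le> r" "r \<le> 3/4" "shannon_capacity (?F m) = ereal (- ln r)"
        "\<forall>x. 0 < x \<longrightarrow> x < r \<longrightarrow> (\<exists>\<phi>. first_hit_masses (?F m) m r x \<phi>)"
        by (rule capacity_radius[OF fin len elim(2) \<open>card (?F m) * (3/4) ^ m < (1/2::real)\<close>])
      hence "good m r" unfolding good_def by blast
      thus ?thesis by (rule that)
    qed
    thus ?case using elim unfolding R_def by (metis someI)
  qed
  have distinct: "\<forall>\<^sub>F m in sequentially. inj_on (\<lambda>i. stem (z i) m) I"
    using eventually_stem_eq_iff[OF I, of 0 z]
    by eventually_elim (use inj in \<open>auto simp: inj_on_def\<close>)
  show thesis
  proof (rule that[of R])
    show "\<forall>\<^sub>F m in sequentially. shannon_capacity (?F m) = ereal (- ln (R m))"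
      using good by eventually_elim (simp add: good_def)
    show "\<forall>\<^sub>F m in sequentially. 1/2 \<le> R m \<and> R m \<le> 3/4"
      using good by eventually_elim (simp add: good_def)
    show "\<forall>\<^sub>F m in sequentially. 2 * R m - 1 \<le> card I * R m ^ m"
      using good
    proof eventually_elim
      case (elim m)
      have "2 * x - 1 \<le> card I * x ^ m" if x: "0 < x" "x < R m" for x :: real
      proof -
        have "\<exists>\<phi>. first_hit_masses (?F m) m (R m) x \<phi>" using elim x by (simp add: good_def)
        then obtain \<phi> where "first_hit_masses (?F m) m (R m) x \<phi>" ..
        hence \<phi>: "\<forall>u. 0 \<le> \<phi> u" "2 * x - 1 \<le> (\<Sum>u\<in>?F m. \<phi> u)"
          "\<forall>u\<in>?F m. x ^ m = (\<Sum>v\<in>?F m. overlap v u x * \<phi> v)"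
          unfolding first_hit_masses_def by blast+
        have ne: "[] \<notin> ?F m"
        proof
          assume "[] \<in> ?F m"
          then obtain i where "[] = stem (z i) m" by blast
          from arg_cong[OF this, of length] have "m = 0" by simp
          thus False using elim by simp
        qed
        have "(\<Sum>u\<in>?F m. \<phi> u) \<le> card (?F m) * x ^ m"
          using \<phi> x I ne by (intro sum_le_card_times_power) auto
        also have "\<dots> \<le> card I * x ^ m"
          using x I by (intro mult_right_mono of_nat_mono card_image_le) auto
        finally show ?thesis using \<phi>(2) by linarith
      qed
      moreover have "0 < R m" using elim by (simp add: good_def)
      ultimately have "\<forall>\<^sub>F x in at_left (R m). 2 * x - 1 \<le> card I * x ^ m"
        by (intro eventually_at_leftI[of 0]) auto
      thus ?case
        by (intro tendsto_le[where F = "at_left (R m)" and f = "\<lambda>x. card I * x ^ m" and g = "\<lambda>x. 2 * x - 1"])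
           (auto intro!: tendsto_intros)
    qed
    have "\<forall>\<^sub>F m in sequentially.
      (1 - \<delta>) * (2 * R m - 1) \<le> Y (R m) * R m ^ m \<and> Y (R m) * R m ^ m \<le> (1 + \<delta>) * (2 * R m - 1)"
      if \<delta>: "0 < \<delta>" "\<delta> \<le> 1" for \<delta>
      using good distinct eventually_weighted_overlap[OF I inj \<delta>(1)]
    proof eventually_elim
      case (elim m)
      let ?w = "\<lambda>i. stem (z i) m"
      \<comment> \<open>transport the weights from indices to words\<close>
      define y where "y u x = 1 - return_weight (z ` I) x (z (inv_into I ?w u))" for u x
      have y: "y (?w i) x = 1 - return_weight (z ` I) x (z i)" if "i \<in> I" for i x
        unfolding y_def inv_into_f_f[OF elim(2) that] ..
      have Y: "(\<Sum>u\<in>?F m. y u x) = Y x" for x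
        unfolding Y_def sum.reindex[OF elim(2)] using y by simp
      have approx: "\<bar>(\<Sum>u\<in>?F m. y u x * overlap v u x) - 1\<bar> \<le> \<delta>"
        if x: "0 \<le> x" "x \<le> 3/4" and v: "v \<in> ?F m" for x v
      proof -
        obtain j where "j \<in> I" "v = ?w j" using v by blast
        moreover have "(\<Sum>u\<in>?F m. y u x * overlap v u x) =
            (\<Sum>i\<in>I. (1 - return_weight (z ` I) x (z i)) * overlap v (?w i) x)"
          unfolding sum.reindex[OF elim(2)] using y by simp
        ultimately show ?thesis using elim x by simp
      qed
      have cont: "isCont (y u) (R m)" for u
        unfolding y_def[abs_def] by (intro continuous_intros isCont_return_weight)
      have ex: "\<exists>\<phi>. first_hit_masses (?F m) m (R m) x \<phi>" if "0 < x" "x < R m" for x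
        using elim that unfolding good_def by blast
      have R: "0 < R m" "R m \<le> 3/4" using elim by (auto simp: good_def)
      have "finite (?F m)" using I by simp
      from radius_equation_approx[OF this R ex cont _ \<delta>(2) approx] \<delta>(1)
      show ?case unfolding Y by simp
    qed
    thus "\<forall>\<delta>. 0 < \<delta> \<longrightarrow> \<delta> \<le> 1 \<longrightarrow> (\<forall>\<^sub>F m in sequentially.
      (1 - \<delta>) * (2 * R m - 1) \<le> Y (R m) * R m ^ m \<and> Y (R m) * R m ^ m \<le> (1 + \<delta>) * (2 * R m - 1))"
      by blast
  qed
qed

theorem mainTheorem6:
  fixes p m0 :: nat
    and B :: "nat \<Rightarrow> nat \<Rightarrow> bool list"
    and z :: "nat \<Rightarrow> nat \<Rightarrow> bool"
  assumes "p \<ge> 1"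
    and "\<And>i m. i \<in> {1..p} \<Longrightarrow> m \<ge> m0 \<Longrightarrow> length (B i m) = m"
    and "\<And>m. m \<ge> m0 \<Longrightarrow> inj_on (\<lambda>i. B i m) {1..p}"
    and "\<And>i m. i \<in> {1..p} \<Longrightarrow> m \<ge> m0 \<Longrightarrow> z i \<in> cylinder (B i m)"
  shows "(\<lambda>m. (ereal (ln 2) - shannon_capacity ((\<lambda>i. B i m) ` {1..p})) / ereal (1 / 2 ^ m))
           \<longlonglongrightarrow> ereal (\<Sum>i\<in>{1..p}. 1 - two_power_minus (hitting_time (z ` {1..p}) (z i)))"
proof -
  let ?I = "{1..p}"
  define Y where "Y x = (\<Sum>i\<in>?I. 1 - return_weight (z ` ?I) x (z i))" for x
  have B: "B i m = stem (z i) m" if "i \<in> ?I" "m \<ge> m0" for i m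
    using assms(2,4)[OF that] by (simp add: cylinder_iff_stem)
  have inj: "inj_on z ?I"
  proof (rule inj_onI)
    fix i k assume ik: "i \<in> ?I" "k \<in> ?I" "z i = z k"
    hence "B i m0 = B k m0" using B[of _ m0] by simp
    thus "i = k" using ik by (intro inj_onD[OF assms(3)[OF order_refl]])
  qed
  obtain R :: "nat \<Rightarrow> real" where R:
    "\<forall>\<^sub>F m in sequentially. shannon_capacity ((\<lambda>i. stem (z i) m) ` ?I) = ereal (- ln (R m))"
    "\<forall>\<^sub>F m in sequentially. 1/2 \<le> R m \<and> R m \<le> 3/4"
    "\<forall>\<^sub>F m in sequentially. 2 * R m - 1 \<le> card ?I * R m ^ m"
    "\<forall>\<delta>. 0 < \<delta> \<longrightarrow> \<delta> \<le> 1 \<longrightarrow> (\<forall>\<^sub>F m in sequentially.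
      (1 - \<delta>) * (2 * R m - 1) \<le> Y (R m) * R m ^ m \<and> Y (R m) * R m ^ m \<le> (1 + \<delta>) * (2 * R m - 1))"
    by (rule eventually_capacity_radius[OF finite_atLeastAtMost inj, folded Y_def])
  have "isCont Y (1/2)"
    unfolding Y_def[abs_def] by (intro continuous_intros isCont_return_weight)
  hence "(\<lambda>m. 2 ^ m * (ln 2 + ln (R m))) \<longlonglongrightarrow> Y (1/2)"
    using R by (intro radius_asymptotics) auto
  hence "(\<lambda>m. ereal (2 ^ m * (ln 2 + ln (R m)))) \<longlonglongrightarrow> ereal (Y (1/2))" by simp
  moreover have "\<forall>\<^sub>F m in sequentially. ereal (2 ^ m * (ln 2 + ln (R m))) =
      (ereal (ln 2) - shannon_capacity ((\<lambda>i. B i m) ` ?I)) / ereal (1 / 2 ^ m)"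
    using R(1) eventually_ge_at_top[of m0]
  proof eventually_elim
    case (elim m)
    have "(\<lambda>i. B i m) ` ?I = (\<lambda>i. stem (z i) m) ` ?I" using B elim by (intro image_cong) auto
    thus ?case using elim by (simp add: mult.commute)
  qed
  ultimately have "(\<lambda>m. (ereal (ln 2) - shannon_capacity ((\<lambda>i. B i m) ` ?I)) / ereal (1 / 2 ^ m))
      \<longlonglongrightarrow> ereal (Y (1/2))"
    by (rule Lim_transform_eventually)
  thus ?thesis unfolding Y_def by (simp only: return_weight_half)
qed

end
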